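(* Let $(X,f)$ be a proximal Cantor system with topological rank $2$, represented as the inverse limit of a bidirectional proximal KR-covering $G_0\xleftarrow{\varphi_1}G_1\xleftarrow{\varphi_2}\cdots$ such that for every $n\ge1$ the graph $G_n$ has exactly two circuits, $e_n$ of length $1$ and $c_n$ of length $l_n\geq 2$. For each $n\ge1$ write $$\varphi_{n+1}(c_{n+1})=e_n^{a(n,0)}\prod_{j=1}^{b(n)}\left(c_n\,e_n^{a(n,j)}\right)$$ with $b(n)\ge1$, $a(n,0)>0$, $a(n,b(n))>0$ and $a(n,j)\ge0$ for $0<j<b(n)$, and put $$r(n):=\frac{l_{n+1}-\sum_{j=0}^{b(n)}a(n,j)}{l_{n+1}}.$$ Then $(X,f)$ is uniquely ergodic if and only if $\sum_{i=1}^{\infty}(1-r(i))=\infty$.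
   Context: Systems. A (homeomorphic) zero-dimensional system is a pair $(X,f)$ with $X$ a compact totally disconnected metric space (metric $d$) and $f:X\to X$ a homeomorphism; it is a Cantor system if $X$ is homeomorphic to the Cantor set. It is proximal if $\liminf_{n\to+\infty}d(f^n(x),f^n(y))=0$ for all $x,y\in X$. It is essentially minimal if it has a unique minimal set (proximal systems are). Uniquely ergodic means having exactly one invariant Borel probability measure. Topological rank. A Bratteli diagram is an infinite directed graph $(V,E)$ with $V=V_0\sqcup V_1\sqcup\cdots$, $E=E_1\sqcup E_2\sqcup\cdots$ (all parts finite and non-empty), $V_0=\{v_0\}$, source and range maps $s:E_n\to V_{n-1}$, $r:E_n\to V_n$ with $s^{-1}(v)\neq\emptyset$ for all $v\in V$ and $r^{-1}(v)\ne\emptyset$ for all $v\in V\setminus V_0$ (multiple edges allowed). Its rank is $\liminf_{n\to\infty}|V_n|$. It is ordered if each $r^{-1}(v)$, $v\in V\setminus V_0$, carries a linear order. It is essentially simple if there is a unique infinite path $p_{\max}$ from $V_0$ all of whose edges are maximal in their sets $r^{-1}(\cdot)$, and a unique infinite path $p_{\min}$ from $V_0$ all of whose edges are minimal. Let $E_{0,\infty}=\{(e_1,e_2,\dots):e_i\in E_i,\ r(e_i)=s(e_{i+1})\}$ with the product topology. The Vershik map $\phi:E_{0,\infty}\to E_{0,\infty}$ sends $p_{\max}$ to $p_{\min}$, and for $e\ne p_{\max}$, with $n$ least such that $e_n$ is not maximal, $f_n$ the successor of $e_n$ in $r^{-1}(r(e_n))$ and $(f_1,\dots,f_{n-1})$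 the path of minimal edges from $v_0$ to $s(f_n)$, $\phi(e)=(f_1,\dots,f_n,e_{n+1},e_{n+2},\dots)$. An essentially minimal zero-dimensional system has topological rank $K$ ($1\le K\le\infty$) if $K$ is the minimum of the ranks of the essentially simple ordered Bratteli diagrams whose Vershik system $(E_{0,\infty},\phi)$ is topologically conjugate to it. Graph coverings. A finite directed graph $G=(V(G),E(G))$ has $E(G)\subseteq V(G)\times V(G)$, and every vertex is assumed to have an incoming and an outgoing edge. A graph homomorphism $\varphi:G_1\to G_2$ is edge-surjective if $\varphi(E(G_1))=E(G_2)$; it is $+$directional if $(u,v),(u,v')\in E(G_1)$ implies $\varphi(v)=\varphi(v')$; it is bidirectional if moreover $(u,v),(u',v)\in E(G_1)$ implies $\varphi(u)=\varphi(u')$. A cover is a $+$directional edge-surjective homomorphism. A covering is a sequence of covers $G_0\xleftarrow{\varphi_1}G_1\xleftarrow{\varphi_2}\cdots$ with $G_0$ the graph with one vertex and one loop; it is bidirectional if all $\varphi_n$ are. Its inverse limit is $(X,f)$ with $X=\{(v_0,v_1,\dots)\in\prod_nV(G_n): v_n=\varphi_{n+1}(v_{n+1})\}$ and $f(x)=y$ iff $(u_n,v_n)\in E(G_n)$ for all $n$, where $x=(u_n)_n$, $y=(v_n)_n$. A circuit of length (period) $l\ge1$ is a closed walk $(v_0,\dots,v_l=v_0)$ with $v_0,\dots,v_{l-1}$ distinct. A generalized figure 8 is a graph $G$ with a center $v_0$ and distinct circuits $c_1,\dots,c_r$ starting at $v_0$, pairwise meeting only in $v_0$, whose edges exhaust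 $E(G)$; $r$ is its rank. A KR-covering is a covering in which each $G_n$ is a generalized figure 8 with center $v_{n,0}$ and $\varphi_{n+1}(v_{n+1,0})=v_{n,0}$ for all $n\ge0$. It is proximal if for each $n\ge1$ the graph $G_n$ has a unique circuit of length $1$. The image of a walk under $\varphi_{n+1}$ is taken vertexwise; products and powers of closed walks at the center denote concatenation. Every proximal Cantor system with topological rank $2$ is (up to conjugacy) the inverse limit of such a covering with all $G_n$, $n\ge1$, of rank $2$, and $\varphi_{n+1}(c_{n+1})$ then automatically has the displayed form. *)

theory Defs
  imports "HOL-Probability.Probability" "Graph_Theory.Graph_Theory"
begin

definition totally_disconnected :: "'a topology \<Rightarrow> bool" where
  "totally_disconnected T \<longleftrightarrow> (\<forall>S. connectedin T S \<longrightarrow> (\<exists>x. S \<subseteq> {x}))"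

text \<open>The middle-thirds set: the reals with a ternary expansion that avoids the digit 1.\<close>

definition cantor_set :: "real set" where
  "cantor_set = {x. \<exists>a :: nat \<Rightarrow> real. (\<forall>i. a i \<in> {0, 2}) \<and> (\<lambda>i. a i / 3 ^ Suc i) sums x}"

definition zero_dim_system :: "'a metric \<Rightarrow> ('a \<Rightarrow> 'a) \<Rightarrow> bool" where
  "zero_dim_system X f \<longleftrightarrow>
     compact_space (mtopology_of X) \<and> totally_disconnected (mtopology_of X) \<and>
     homeomorphic_map (mtopology_of X) (mtopology_of X) f"

definition cantor_system :: "'a metric \<Rightarrow> ('a \<Rightarrow> 'a) \<Rightarrow> bool" where
  "cantor_system X f \<longleftrightarrow>
     zero_dim_system X f \<and> mtopology_of X homeomorphic_space top_of_set cantor_set"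

definition proximal_system :: "'a metric \<Rightarrow> ('a \<Rightarrow> 'a) \<Rightarrow> bool" where
  "proximal_system X f \<longleftrightarrow>
     (\<forall>x\<in>mspace X. \<forall>y\<in>mspace X.
        liminf (\<lambda>n. ereal (mdist X ((f ^^ n) x) ((f ^^ n) y))) = 0)"

definition invariant_closed :: "'a topology \<Rightarrow> ('a \<Rightarrow> 'a) \<Rightarrow> 'a set \<Rightarrow> bool" where
  "invariant_closed T f M \<longleftrightarrow> closedin T M \<and> M \<noteq> {} \<and> f ` M = M"

definition minimal_set :: "'a topology \<Rightarrow> ('a \<Rightarrow> 'a) \<Rightarrow> 'a set \<Rightarrow> bool" where
  "minimal_set T f M \<longleftrightarrow>
     invariant_closed T f M \<and> (\<forall>N. invariant_closed T f N \<and> N \<subseteq> M \<longrightarrow> N = M)"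

definition essentially_minimal :: "'a topology \<Rightarrow> ('a \<Rightarrow> 'a) \<Rightarrow> bool" where
  "essentially_minimal T f \<longleftrightarrow> (\<exists>!M. minimal_set T f M)"

definition top_conjugate ::
    "'a topology \<Rightarrow> ('a \<Rightarrow> 'a) \<Rightarrow> 'b topology \<Rightarrow> ('b \<Rightarrow> 'b) \<Rightarrow> bool" where
  "top_conjugate T f S g \<longleftrightarrow>
     (\<exists>h. homeomorphic_map T S h \<and> (\<forall>x\<in>topspace T. h (f x) = g (h x)))"

definition invariant_borel_prob :: "'a topology \<Rightarrow> ('a \<Rightarrow> 'a) \<Rightarrow> 'a measure \<Rightarrow> bool" where
  "invariant_borel_prob T f \<mu> \<longleftrightarrow>
     sets \<mu> = sigma_sets (topspace T) {U. openin T U} \<and> prob_space \<mu> \<and>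
     f \<in> \<mu> \<rightarrow>\<^sub>M \<mu> \<and> distr \<mu> \<mu> f = \<mu>"

definition uniquely_ergodic :: "'a topology \<Rightarrow> ('a \<Rightarrow> 'a) \<Rightarrow> bool" where
  "uniquely_ergodic T f \<longleftrightarrow> (\<exists>!\<mu>. invariant_borel_prob T f \<mu>)"

text \<open>
  \<^item> Edges at level \<open>Suc n\<close> go from vertices at level \<open>n\<close> to vertices at level
    \<open>Suc n\<close>; \<open>bedges B 0\<close> is not used.
  \<^item> \<open>bord B v\<close> is the (reflexive) order on the edges with range \<open>v\<close>.
  \<^item> An infinite path is a function \<open>p\<close> whose value \<open>p n\<close> is the edge at level
    \<open>Suc n\<close>.
\<close>

record ('v, 'e) bratteli =
  bverts :: "nat \<Rightarrow> 'v set"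
  bedges :: "nat \<Rightarrow> 'e set"
  bsrc :: "'e \<Rightarrow> 'v"
  brng :: "'e \<Rightarrow> 'v"
  bord :: "'v \<Rightarrow> 'e rel"

definition in_edges :: "('v, 'e) bratteli \<Rightarrow> 'v \<Rightarrow> 'e set" where
  "in_edges B v = {d. (\<exists>n. d \<in> bedges B (Suc n)) \<and> brng B d = v}"

definition out_edges :: "('v, 'e) bratteli \<Rightarrow> 'v \<Rightarrow> 'e set" where
  "out_edges B v = {d. (\<exists>n. d \<in> bedges B (Suc n)) \<and> bsrc B d = v}"

definition bratteli_diagram :: "('v, 'e) bratteli \<Rightarrow> bool" where
  "bratteli_diagram B \<longleftrightarrow>
     (\<forall>n. finite (bverts B n) \<and> bverts B n \<noteq> {}) \<and>
     (\<forall>n. finite (bedges B (Suc n)) \<and> bedges B (Suc n) \<noteq> {}) \<and>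
     disjoint_family (bverts B) \<and> disjoint_family (\<lambda>n. bedges B (Suc n)) \<and>
     (\<exists>v. bverts B 0 = {v}) \<and>
     (\<forall>n. \<forall>d\<in>bedges B (Suc n). bsrc B d \<in> bverts B n \<and> brng B d \<in> bverts B (Suc n)) \<and>
     (\<forall>n. \<forall>v\<in>bverts B n. out_edges B v \<noteq> {}) \<and>
     (\<forall>n. \<forall>v\<in>bverts B (Suc n). in_edges B v \<noteq> {})"

definition ordered_bratteli_diagram :: "('v, 'e) bratteli \<Rightarrow> bool" where
  "ordered_bratteli_diagram B \<longleftrightarrow>
     bratteli_diagram B \<and>
     (\<forall>n. \<forall>v\<in>bverts B (Suc n). linear_order_on (in_edges B v) (bord B v))"

definition bratteli_rank :: "('v, 'e) bratteli \<Rightarrow> enat" where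
  "bratteli_rank B = liminf (\<lambda>n. enat (card (bverts B n)))"

definition max_edge :: "('v, 'e) bratteli \<Rightarrow> 'e \<Rightarrow> bool" where
  "max_edge B d \<longleftrightarrow> (\<forall>d'\<in>in_edges B (brng B d). (d', d) \<in> bord B (brng B d))"

definition min_edge :: "('v, 'e) bratteli \<Rightarrow> 'e \<Rightarrow> bool" where
  "min_edge B d \<longleftrightarrow> (\<forall>d'\<in>in_edges B (brng B d). (d, d') \<in> bord B (brng B d))"

definition is_succ_edge :: "('v, 'e) bratteli \<Rightarrow> 'e \<Rightarrow> 'e \<Rightarrow> bool" where
  "is_succ_edge B d d' \<longleftrightarrow>
     d' \<noteq> d \<and> (d, d') \<in> bord B (brng B d) \<and>
     (\<forall>x. x \<noteq> d \<and> (d, x) \<in> bord B (brng B d) \<longrightarrow> (d', x) \<in> bord B (brng B d))"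

definition bpaths :: "('v, 'e) bratteli \<Rightarrow> (nat \<Rightarrow> 'e) set" where
  "bpaths B = {p. \<forall>n. p n \<in> bedges B (Suc n) \<and> brng B (p n) = bsrc B (p (Suc n))}"

definition max_path :: "('v, 'e) bratteli \<Rightarrow> (nat \<Rightarrow> 'e) \<Rightarrow> bool" where
  "max_path B p \<longleftrightarrow> p \<in> bpaths B \<and> (\<forall>n. max_edge B (p n))"

definition min_path :: "('v, 'e) bratteli \<Rightarrow> (nat \<Rightarrow> 'e) \<Rightarrow> bool" where
  "min_path B p \<longleftrightarrow> p \<in> bpaths B \<and> (\<forall>n. min_edge B (p n))"

definition essentially_simple :: "('v, 'e) bratteli \<Rightarrow> bool" where
  "essentially_simple B \<longleftrightarrow> (\<exists>!p. max_path B p) \<and> (\<exists>!p. min_path B p)"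

definition path_topology :: "('v, 'e) bratteli \<Rightarrow> (nat \<Rightarrow> 'e) topology" where
  "path_topology B =
     subtopology (product_topology (\<lambda>n. discrete_topology (bedges B (Suc n))) UNIV) (bpaths B)"

definition vershik :: "('v, 'e) bratteli \<Rightarrow> (nat \<Rightarrow> 'e) \<Rightarrow> (nat \<Rightarrow> 'e)" where
  "vershik B p =
     (if max_path B p then (THE q. min_path B q)
      else let n = (LEAST n. \<not> max_edge B (p n)) in
        (THE q. q \<in> bpaths B \<and> (\<forall>i<n. min_edge B (q i)) \<and>
                is_succ_edge B (p n) (q n) \<and> (\<forall>i>n. q i = p i)))"

definition bratteli_model ::
    "'a topology \<Rightarrow> ('a \<Rightarrow> 'a) \<Rightarrow> ('v, 'e) bratteli \<Rightarrow> bool" where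
  "bratteli_model T f B \<longleftrightarrow>
     ordered_bratteli_diagram B \<and> essentially_simple B \<and>
     top_conjugate T f (path_topology B) (vershik B)"

text \<open>
  All vertex and edge sets of a Bratteli diagram are countable, so diagrams with natural
  numbers as vertices and edges represent all diagrams up to isomorphism.
\<close>

definition has_topological_rank :: "'a metric \<Rightarrow> ('a \<Rightarrow> 'a) \<Rightarrow> enat \<Rightarrow> bool" where
  "has_topological_rank X f K \<longleftrightarrow>
     zero_dim_system X f \<and> essentially_minimal (mtopology_of X) f \<and>
     (\<exists>B :: (nat, nat) bratteli. bratteli_model (mtopology_of X) f B \<and> bratteli_rank B = K) \<and>
     (\<forall>B :: (nat, nat) bratteli. bratteli_model (mtopology_of X) f B \<longrightarrow> K \<le> bratteli_rank B)"

definition covering_graph :: "'v pair_pre_digraph \<Rightarrow> bool" where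
  "covering_graph G \<longleftrightarrow>
     pair_fin_digraph G \<and>
     (\<forall>v\<in>pverts G. (\<exists>u. (u, v) \<in> parcs G) \<and> (\<exists>w. (v, w) \<in> parcs G))"

definition graph_hom ::
    "('v \<Rightarrow> 'v) \<Rightarrow> 'v pair_pre_digraph \<Rightarrow> 'v pair_pre_digraph \<Rightarrow> bool" where
  "graph_hom \<phi> G H \<longleftrightarrow>
     \<phi> ` pverts G \<subseteq> pverts H \<and> (\<forall>(u, v)\<in>parcs G. (\<phi> u, \<phi> v) \<in> parcs H)"

definition edge_surjective ::
    "('v \<Rightarrow> 'v) \<Rightarrow> 'v pair_pre_digraph \<Rightarrow> 'v pair_pre_digraph \<Rightarrow> bool" where
  "edge_surjective \<phi> G H \<longleftrightarrow> map_prod \<phi> \<phi> ` parcs G = parcs H"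

definition plus_directional :: "('v \<Rightarrow> 'v) \<Rightarrow> 'v pair_pre_digraph \<Rightarrow> bool" where
  "plus_directional \<phi> G \<longleftrightarrow>
     (\<forall>u v v'. (u, v) \<in> parcs G \<and> (u, v') \<in> parcs G \<longrightarrow> \<phi> v = \<phi> v')"

definition bidirectional :: "('v \<Rightarrow> 'v) \<Rightarrow> 'v pair_pre_digraph \<Rightarrow> bool" where
  "bidirectional \<phi> G \<longleftrightarrow>
     plus_directional \<phi> G \<and>
     (\<forall>u u' v. (u, v) \<in> parcs G \<and> (u', v) \<in> parcs G \<longrightarrow> \<phi> u = \<phi> u')"

definition graph_cover ::
    "('v \<Rightarrow> 'v) \<Rightarrow> 'v pair_pre_digraph \<Rightarrow> 'v pair_pre_digraph \<Rightarrow> bool" where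
  "graph_cover \<phi> G H \<longleftrightarrow> graph_hom \<phi> G H \<and> edge_surjective \<phi> G H \<and> plus_directional \<phi> G"

text \<open>\<open>\<phi> (Suc n)\<close> maps \<open>G (Suc n)\<close> to \<open>G n\<close>; \<open>\<phi> 0\<close> is not used.\<close>

definition covering :: "(nat \<Rightarrow> 'v pair_pre_digraph) \<Rightarrow> (nat \<Rightarrow> 'v \<Rightarrow> 'v) \<Rightarrow> bool" where
  "covering G \<phi> \<longleftrightarrow>
     (\<forall>n. covering_graph (G n)) \<and>
     (\<exists>v. pverts (G 0) = {v} \<and> parcs (G 0) = {(v, v)}) \<and>
     (\<forall>n. graph_cover (\<phi> (Suc n)) (G (Suc n)) (G n))"

definition bidirectional_covering ::
    "(nat \<Rightarrow> 'v pair_pre_digraph) \<Rightarrow> (nat \<Rightarrow> 'v \<Rightarrow> 'v) \<Rightarrow> bool" where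
  "bidirectional_covering G \<phi> \<longleftrightarrow>
     covering G \<phi> \<and> (\<forall>n. bidirectional (\<phi> (Suc n)) (G (Suc n)))"

definition inv_limit :: "(nat \<Rightarrow> 'v pair_pre_digraph) \<Rightarrow> (nat \<Rightarrow> 'v \<Rightarrow> 'v) \<Rightarrow> (nat \<Rightarrow> 'v) set" where
  "inv_limit G \<phi> = {x. \<forall>n. x n \<in> pverts (G n) \<and> x n = \<phi> (Suc n) (x (Suc n))}"

definition inv_limit_topology ::
    "(nat \<Rightarrow> 'v pair_pre_digraph) \<Rightarrow> (nat \<Rightarrow> 'v \<Rightarrow> 'v) \<Rightarrow> (nat \<Rightarrow> 'v) topology" where
  "inv_limit_topology G \<phi> =
     subtopology (product_topology (\<lambda>n. discrete_topology (pverts (G n))) UNIV) (inv_limit G \<phi>)"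

definition inv_limit_map ::
    "(nat \<Rightarrow> 'v pair_pre_digraph) \<Rightarrow> (nat \<Rightarrow> 'v \<Rightarrow> 'v) \<Rightarrow> (nat \<Rightarrow> 'v) \<Rightarrow> (nat \<Rightarrow> 'v)" where
  "inv_limit_map G \<phi> x = (THE y. y \<in> inv_limit G \<phi> \<and> (\<forall>n. (x n, y n) \<in> parcs (G n)))"

text \<open>
  A walk is the list of its vertices, so a closed walk repeats its first vertex at the end,
  and its length is \<^const>\<open>vwalk_length\<close>, one less than the length of the list.
\<close>

definition circuit :: "'v pair_pre_digraph \<Rightarrow> 'v vwalk \<Rightarrow> bool" where
  "circuit G c \<longleftrightarrow>
     vwalk c (with_proj G) \<and> vwalk_length c \<ge> 1 \<and> hd c = last c \<and> distinct (butlast c)"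

definition generalized_figure_8 :: "'v pair_pre_digraph \<Rightarrow> 'v \<Rightarrow> nat \<Rightarrow> bool" where
  "generalized_figure_8 G v r \<longleftrightarrow>
     v \<in> pverts G \<and>
     (\<exists>C. finite C \<and> card C = r \<and>
        (\<forall>c\<in>C. circuit G c \<and> hd c = v) \<and>
        (\<forall>c\<in>C. \<forall>c'\<in>C. c \<noteq> c' \<longrightarrow> set c \<inter> set c' = {v}) \<and>
        (\<Union>c\<in>C. set (vwalk_arcs c)) = parcs G)"

definition KR_covering ::
    "(nat \<Rightarrow> 'v pair_pre_digraph) \<Rightarrow> (nat \<Rightarrow> 'v \<Rightarrow> 'v) \<Rightarrow> (nat \<Rightarrow> 'v) \<Rightarrow> bool" where
  "KR_covering G \<phi> ctr \<longleftrightarrow>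
     covering G \<phi> \<and> (\<forall>n. \<exists>r. generalized_figure_8 (G n) (ctr n) r) \<and>
     (\<forall>n. \<phi> (Suc n) (ctr (Suc n)) = ctr n)"

definition proximal_KR_covering ::
    "(nat \<Rightarrow> 'v pair_pre_digraph) \<Rightarrow> (nat \<Rightarrow> 'v \<Rightarrow> 'v) \<Rightarrow> (nat \<Rightarrow> 'v) \<Rightarrow> bool" where
  "proximal_KR_covering G \<phi> ctr \<longleftrightarrow>
     KR_covering G \<phi> ctr \<and> (\<forall>n\<ge>1. \<exists>!c. circuit (G n) c \<and> vwalk_length c = 1)"

text \<open>
  Product of closed walks at \<open>v\<close>. The empty product is the walk of length 0
  at \<open>v\<close>.
\<close>

definition walk_prod :: "'v \<Rightarrow> 'v vwalk list \<Rightarrow> 'v vwalk" where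
  "walk_prod v ws = foldr vwalk_join ws [v]"

definition walk_pow :: "'v \<Rightarrow> 'v vwalk \<Rightarrow> nat \<Rightarrow> 'v vwalk" where
  "walk_pow v w k = walk_prod v (replicate k w)"

end

theory Submission
  imports Defs
begin

text \<open>
  The constant sequence of centers is a fixed point, because every center carries a loop.  So the
  Dirac measure there is invariant (\<open>dirac_invariant\<close>), and the question is whether there is a
  second invariant measure.

  An invariant probability measure \<open>\<mu>\<close> is determined by one number per level.  A vertex of the long
  circuit \<open>c\<^sub>n\<close> other than the center has only one arc coming in and one going out, so if the next
  vertex is not the center either, the preimage of its cylinder is the cylinder of the first one.
  Hence all cylinders of noncentral vertices have the same measure, the height \<open>m\<^sub>n\<close>
  (\<open>measure_noncentral\<close>).  The image of \<open>c\<^sub>n\<^sub>+\<^sub>1\<close> runs \<open>b\<^sub>n\<close> times around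
  \<open>c\<^sub>n\<close>, so the cylinder of a noncentral vertex of level \<open>n\<close> splits into \<open>b\<^sub>n\<close> such cylinders of level
  \<open>n + 1\<close>; this gives \<open>m\<^sub>n = b\<^sub>n * m\<^sub>n\<^sub>+\<^sub>1\<close> (\<open>height_step\<close>).  The total mass gives
  \<open>(l\<^sub>n - 1) * m\<^sub>n \<le> 1\<close> (\<open>height_total\<close>).  Conversely, every nonnegative solution of these two
  conditions is realized by an invariant measure, which gives the remaining mass to the centers
  (\<open>ex_invariant_with_heights\<close>).

  Comparing lengths in the formula for the image of \<open>c\<^sub>n\<^sub>+\<^sub>1\<close> shows \<open>r\<^sub>n = b\<^sub>n * l\<^sub>n / l\<^sub>n\<^sub>+\<^sub>1\<close>.  Hence
  \<open>m\<^sub>n * l\<^sub>n = r\<^sub>n * (m\<^sub>n\<^sub>+\<^sub>1 * l\<^sub>n\<^sub>+\<^sub>1)\<close>, and \<open>m\<^sub>1 * l\<^sub>1\<close> is the product of \<open>r\<^sub>1, \<dots>, r\<^sub>N\<close> times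
  \<open>m\<^sub>N\<^sub>+\<^sub>1 * l\<^sub>N\<^sub>+\<^sub>1\<close>, which is at most 2.  If the sum of the \<open>1 - r\<^sub>i\<close> diverges, the product tends to 0, so
  all heights vanish and \<open>\<mu>\<close> is the Dirac measure.  If the sum converges, the products stay above some
  \<open>\<delta> > 0\<close>, and the solution with \<open>m\<^sub>1 = \<delta> / l\<^sub>1\<close> is a second invariant measure
  (\<open>uniquely_ergodic_iff_sum_diverges\<close>).
\<close>

section \<open>Conjugate systems have the same invariant measures\<close>

definition top_borel :: "'a topology \<Rightarrow> 'a measure" where
  "top_borel T = sigma (topspace T) {U. openin T U}"

lemma space_top_borel [simp]: "space (top_borel T) = topspace T"
  by (auto simp: top_borel_def space_measure_of_conv)

lemma sets_top_borel: "sets (top_borel T) = sigma_sets (topspace T) {U. openin T U}"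
  unfolding top_borel_def by (rule sets_measure_of) (auto dest: openin_subset)

lemma invariant_borel_prob_altdef:
  "invariant_borel_prob T f \<mu> \<longleftrightarrow>
     sets \<mu> = sets (top_borel T) \<and> prob_space \<mu> \<and> f \<in> top_borel T \<rightarrow>\<^sub>M top_borel T \<and> distr \<mu> \<mu> f = \<mu>"
proof -
  have "f \<in> \<mu> \<rightarrow>\<^sub>M \<mu> \<longleftrightarrow> f \<in> top_borel T \<rightarrow>\<^sub>M top_borel T" if "sets \<mu> = sets (top_borel T)"
    using measurable_cong_sets[OF that that] by blast
  then show ?thesis
    unfolding invariant_borel_prob_def sets_top_borel by auto
qed

lemma continuous_map_measurable_top_borel:
  assumes "continuous_map T S h"
  shows "h \<in> top_borel T \<rightarrow>\<^sub>M top_borel S"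
  unfolding top_borel_def[of S]
proof (rule measurable_measure_of)
  show "{U. openin S U} \<subseteq> Pow (topspace S)"
    by (auto dest: openin_subset)
  show "h \<in> space (top_borel T) \<rightarrow> topspace S"
    using continuous_map_image_subset_topspace[OF assms] by auto
  fix U assume "U \<in> {U. openin S U}"
  then have "openin T {x \<in> topspace T. h x \<in> U}"
    using assms by (simp add: continuous_map_def)
  moreover have "h -` U \<inter> space (top_borel T) = {x \<in> topspace T. h x \<in> U}"
    by auto
  ultimately show "h -` U \<inter> space (top_borel T) \<in> sets (top_borel T)"
    by (auto simp: sets_top_borel)
qed

text \<open>
  Pushing forward along the inverse homeomorphism undoes the push-forward, so invariant measures of
  conjugate systems correspond one to one.
\<close>

lemma invariant_borel_prob_push:
  assumes hk: "homeomorphic_maps T S h k"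
    and conj: "\<And>x. x \<in> topspace T \<Longrightarrow> h (f x) = g (h x)"
    and f: "f \<in> topspace T \<rightarrow> topspace T"
    and inv: "invariant_borel_prob T f \<mu>"
  shows "invariant_borel_prob S g (distr \<mu> (top_borel S) h)"
    and "distr (distr \<mu> (top_borel S) h) (top_borel T) k = \<mu>"
proof -
  let ?\<nu> = "distr \<mu> (top_borel S) h"
  have ch: "continuous_map T S h" and ck: "continuous_map S T k"
    and kh: "\<And>x. x \<in> topspace T \<Longrightarrow> k (h x) = x" and hk': "\<And>y. y \<in> topspace S \<Longrightarrow> h (k y) = y"
    using hk by (auto simp: homeomorphic_maps_def)
  have sets\<mu>: "sets \<mu> = sets (top_borel T)" and prob: "prob_space \<mu>"
    and fm0: "f \<in> top_borel T \<rightarrow>\<^sub>M top_borel T" and df: "distr \<mu> \<mu> f = \<mu>"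
    using inv by (auto simp: invariant_borel_prob_altdef)
  have sp: "space \<mu> = topspace T"
    using sets_eq_imp_space_eq[OF sets\<mu>] by simp
  have hm0: "h \<in> top_borel T \<rightarrow>\<^sub>M top_borel S" and km: "k \<in> top_borel S \<rightarrow>\<^sub>M top_borel T"
    using ch ck by (auto intro: continuous_map_measurable_top_borel)
  have hm: "h \<in> \<mu> \<rightarrow>\<^sub>M top_borel S" and fm: "f \<in> \<mu> \<rightarrow>\<^sub>M \<mu>"
    using hm0 fm0 measurable_cong_sets[OF sets\<mu> refl] measurable_cong_sets[OF sets\<mu> sets\<mu>] by blast+
  have kS: "k y \<in> topspace T" if "y \<in> topspace S" for y
    using continuous_map_image_subset_topspace[OF ck] that by auto
  have geq: "h (f (k y)) = g y" if "y \<in> topspace S" for y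
    using conj[OF kS[OF that]] hk'[OF that] by simp
  have "(\<lambda>y. h (f (k y))) \<in> top_borel S \<rightarrow>\<^sub>M top_borel S"
    using measurable_comp[OF measurable_comp[OF km fm0] hm0] by (simp add: o_def)
  then have gm: "g \<in> top_borel S \<rightarrow>\<^sub>M top_borel S"
    using measurable_cong[of "top_borel S" "\<lambda>y. h (f (k y))" g "top_borel S"] geq by simp
  have "distr ?\<nu> ?\<nu> g = distr ?\<nu> (top_borel S) g"
    by (rule distr_cong) auto
  also have "\<dots> = distr \<mu> (top_borel S) (g \<circ> h)"
    by (rule distr_distr[OF gm hm])
  also have "\<dots> = distr \<mu> (top_borel S) (h \<circ> f)"
    by (rule distr_cong) (auto simp: sp conj)
  also have "\<dots> = distr (distr \<mu> \<mu> f) (top_borel S) h"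
    by (rule distr_distr[OF hm fm, symmetric])
  finally have "distr ?\<nu> ?\<nu> g = ?\<nu>"
    by (simp add: df)
  then show "invariant_borel_prob S g ?\<nu>"
    using gm prob_space.prob_space_distr[OF prob hm] by (simp add: invariant_borel_prob_altdef)
  have "distr ?\<nu> (top_borel T) k = distr \<mu> (top_borel T) (k \<circ> h)"
    by (rule distr_distr[OF km hm])
  also have "\<dots> = distr \<mu> \<mu> (\<lambda>x. x)"
    by (rule distr_cong) (auto simp: sp sets\<mu> kh)
  finally show "distr ?\<nu> (top_borel T) k = \<mu>"
    by simp
qed

lemma uniquely_ergodic_top_conjugate:
  assumes conj: "top_conjugate T f S g" and f: "f \<in> topspace T \<rightarrow> topspace T"
  shows "uniquely_ergodic T f \<longleftrightarrow> uniquely_ergodic S g"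
proof -
  obtain h where h: "homeomorphic_map T S h" and hf: "\<And>x. x \<in> topspace T \<Longrightarrow> h (f x) = g (h x)"
    using conj by (auto simp: top_conjugate_def)
  obtain k where hk: "homeomorphic_maps T S h k"
    using h by (auto simp: homeomorphic_map_maps)
  have kh: "homeomorphic_maps S T k h"
    using hk homeomorphic_maps_sym by blast
  have hT: "h x \<in> topspace S" if "x \<in> topspace T" for x
    using hk that by (auto simp: homeomorphic_maps_def continuous_map_def Pi_iff)
  have kS: "k y \<in> topspace T" if "y \<in> topspace S" for y
    using hk that by (auto simp: homeomorphic_maps_def continuous_map_def Pi_iff)
  have inv: "\<And>x. x \<in> topspace T \<Longrightarrow> k (h x) = x" "\<And>y. y \<in> topspace S \<Longrightarrow> h (k y) = y"
    using hk by (auto simp: homeomorphic_maps_def)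
  have gy: "g y = h (f (k y))" if "y \<in> topspace S" for y
    using hf[OF kS[OF that]] inv(2)[OF that] by simp
  have g: "g \<in> topspace S \<rightarrow> topspace S"
    using gy f kS hT by (auto simp: Pi_iff)
  have kg: "k (g y) = f (k y)" if "y \<in> topspace S" for y
    using gy[OF that] inv(1) f kS[OF that] by (auto simp: Pi_iff)
  have push: "invariant_borel_prob S g (distr \<mu> (top_borel S) h)"
      "distr (distr \<mu> (top_borel S) h) (top_borel T) k = \<mu>" if "invariant_borel_prob T f \<mu>" for \<mu>
    using invariant_borel_prob_push[of T S h k f g \<mu>, OF hk hf f that] by simp_all
  have pull: "invariant_borel_prob T f (distr \<nu> (top_borel T) k)"
      "distr (distr \<nu> (top_borel T) k) (top_borel S) h = \<nu>" if "invariant_borel_prob S g \<nu>" for \<nu>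
    using invariant_borel_prob_push[of S T k h g f \<nu>, OF kh kg g that] by simp_all
  show ?thesis
    unfolding uniquely_ergodic_def
  proof
    assume "\<exists>!\<mu>. invariant_borel_prob T f \<mu>"
    then show "\<exists>!\<mu>. invariant_borel_prob S g \<mu>"
      using push pull by metis
  next
    assume "\<exists>!\<mu>. invariant_borel_prob S g \<mu>"
    then show "\<exists>!\<mu>. invariant_borel_prob T f \<mu>"
      using push pull by metis
  qed
qed

section \<open>Cylinders in the inverse limit of a covering\<close>

locale graph_covering =
  fixes G :: "nat \<Rightarrow> 'v pair_pre_digraph" and \<phi> :: "nat \<Rightarrow> 'v \<Rightarrow> 'v"
  assumes covering: "covering G \<phi>"
begin

abbreviation V :: "nat \<Rightarrow> 'v set" where "V n \<equiv> pverts (G n)"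
abbreviation X :: "(nat \<Rightarrow> 'v) set" where "X \<equiv> inv_limit G \<phi>"
abbreviation T :: "(nat \<Rightarrow> 'v) topology" where "T \<equiv> inv_limit_topology G \<phi>"
abbreviation F :: "(nat \<Rightarrow> 'v) \<Rightarrow> (nat \<Rightarrow> 'v)" where "F \<equiv> inv_limit_map G \<phi>"

definition cyl :: "nat \<Rightarrow> 'v set \<Rightarrow> (nat \<Rightarrow> 'v) set" where
  "cyl n A = {x \<in> X. x n \<in> A}"

text \<open>
  The vertices of level \<open>n + 1\<close> that know that the next point has its coordinate \<open>n\<close> in \<open>A\<close>: by
  directionality, the coordinate \<open>n\<close> of the next point depends only on the present coordinate
  \<open>n + 1\<close>.
\<close>

definition shift_fibre :: "nat \<Rightarrow> 'v set \<Rightarrow> 'v set" where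
  "shift_fibre n A = {u \<in> V (Suc n). \<exists>w. (u, w) \<in> parcs (G (Suc n)) \<and> \<phi> (Suc n) w \<in> A}"

lemma finite_V: "finite (V n)"
  using covering unfolding covering_def covering_graph_def pair_fin_digraph_def pair_fin_digraph_axioms_def by blast

lemma arc_in_V:
  assumes "(u, v) \<in> parcs (G n)"
  shows "u \<in> V n" "v \<in> V n"
proof -
  have "pair_wf_digraph (G n)"
    using covering by (auto simp: covering_def covering_graph_def pair_fin_digraph_def)
  then show "u \<in> V n" "v \<in> V n"
    using assms by (auto dest: pair_wf_digraph.in_arcsD1 pair_wf_digraph.in_arcsD2)
qed

lemma ex_out_arc: "v \<in> V n \<Longrightarrow> \<exists>w. (v, w) \<in> parcs (G n)"
  using covering unfolding covering_def covering_graph_def by blast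

lemma \<phi>_in_V: "u \<in> V (Suc n) \<Longrightarrow> \<phi> (Suc n) u \<in> V n"
  using covering unfolding covering_def graph_cover_def graph_hom_def by blast

lemma \<phi>_arc: "(u, v) \<in> parcs (G (Suc n)) \<Longrightarrow> (\<phi> (Suc n) u, \<phi> (Suc n) v) \<in> parcs (G n)"
  using covering unfolding covering_def graph_cover_def graph_hom_def by blast

lemma \<phi>_directional:
  "\<lbrakk>(u, v) \<in> parcs (G (Suc n)); (u, v') \<in> parcs (G (Suc n))\<rbrakk> \<Longrightarrow> \<phi> (Suc n) v = \<phi> (Suc n) v'"
  using covering unfolding covering_def graph_cover_def plus_directional_def by blast

lemma \<phi>_surj:
  assumes "v \<in> V n"
  shows "\<exists>u \<in> V (Suc n). \<phi> (Suc n) u = v"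
proof -
  obtain w where "(v, w) \<in> parcs (G n)"
    using ex_out_arc[OF assms] by blast
  moreover have "parcs (G n) = map_prod (\<phi> (Suc n)) (\<phi> (Suc n)) ` parcs (G (Suc n))"
    using covering by (auto simp: covering_def graph_cover_def edge_surjective_def)
  ultimately obtain u u' where "(u, u') \<in> parcs (G (Suc n))" "\<phi> (Suc n) u = v"
    by auto
  then show ?thesis
    using arc_in_V by blast
qed

lemma X_coord:
  assumes "x \<in> X"
  shows "x n \<in> V n" "\<phi> (Suc n) (x (Suc n)) = x n"
proof -
  have "\<forall>n. x n \<in> V n \<and> x n = \<phi> (Suc n) (x (Suc n))"
    using assms unfolding inv_limit_def by (rule CollectD)
  from spec[OF this, of n] show "x n \<in> V n" "\<phi> (Suc n) (x (Suc n)) = x n"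
    by (rule conjunct1, elim conjE) (erule sym)
qed

lemma X_coord_eq:
  assumes "x \<in> X" "y \<in> X" "x n = y n" "i \<le> n"
  shows "x i = y i"
  using assms(4,3)
proof (induction rule: dec_induct)
  case (step m)
  then show ?case
    using X_coord(2)[OF assms(1), of m] X_coord(2)[OF assms(2), of m] by metis
qed simp

lemma topspace_T [simp]: "topspace T = X"
proof -
  have "X \<subseteq> (\<Pi>\<^sub>E n\<in>UNIV. V n)"
    unfolding inv_limit_def PiE_UNIV_domain Pi_iff by blast
  then show ?thesis
    by (simp add: inv_limit_topology_def Int_absorb1)
qed

text \<open>
  Above level \<open>n\<close>, coordinates are chosen by sections of the covering maps; below, they are forced.
  Surjectivity makes the vertex set of a cylinder recoverable from the cylinder, so that a weight
  function on vertices yields a well-defined set function on cylinders.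
\<close>

lemma proj_surj:
  assumes v: "v \<in> V n"
  shows "\<exists>x \<in> X. x n = v"
proof -
  define sec where "sec k v = (SOME u. u \<in> V (Suc k) \<and> \<phi> (Suc k) u = v)" for k v
  have sec: "sec k v \<in> V (Suc k) \<and> \<phi> (Suc k) (sec k v) = v" if "v \<in> V k" for k v
    unfolding sec_def by (rule someI_ex) (use \<phi>_surj[OF that] in blast)
  define up where "up = rec_nat v (\<lambda>j. sec (n + j))"
  define down where "down = rec_nat v (\<lambda>j. \<phi> (n - j))"
  have up: "up 0 = v" "up (Suc j) = sec (n + j) (up j)" 
    and down: "down 0 = v" "down (Suc j) = \<phi> (n - j) (down j)" for j
    by (simp_all add: up_def down_def)
  have upV: "up j \<in> V (n + j)" for j
    by (induction j) (use v sec up in auto)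
  have downV: "j \<le> n \<Longrightarrow> down j \<in> V (n - j)" for j
  proof (induction j)
    case (Suc j)
    then show ?case
      using \<phi>_in_V[of "down j" "n - Suc j"] by (simp add: down Suc_diff_Suc)
  qed (use v down in simp)
  define x where "x k = (if n \<le> k then up (k - n) else down (n - k))" for k
  have "x k \<in> V k \<and> x k = \<phi> (Suc k) (x (Suc k))" for k
  proof (cases "n \<le> k")
    case True
    then have "x k \<in> V k" "x (Suc k) = sec k (x k)"
      using upV[of "k - n"] by (simp_all add: x_def Suc_diff_le up)
    then show ?thesis
      using sec by auto
  next
    case False
    then have "n - k = Suc (n - Suc k)" and d: "x (Suc k) = down (n - Suc k)"
      using up(1) down(1) by (auto simp: x_def)
    then have "x k = \<phi> (n - (n - Suc k)) (down (n - Suc k))"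
      using False down(2)[of "n - Suc k"] by (simp add: x_def)
    with d False downV[of "n - k"] show ?thesis
      by (simp add: x_def)
  qed
  then have "x \<in> X"
    unfolding inv_limit_def by (intro CollectI allI)
  moreover have "x n = v"
    by (simp add: x_def up)
  ultimately show ?thesis
    by blast
qed

lemma proj_cyl: "(\<lambda>x. x n) ` cyl n A = A \<inter> V n"
proof -
  have "x n \<in> V n" if "x \<in> X" for x
    by (rule X_coord(1)[OF that])
  moreover have "\<exists>x. x \<in> X \<and> x n = v" if "v \<in> V n" for v
    using proj_surj[OF that] by blast
  ultimately show ?thesis
    unfolding cyl_def by blast
qed

lemma cyl_lift: "cyl n A = cyl (Suc n) {u \<in> V (Suc n). \<phi> (Suc n) u \<in> A}"
proof -
  have "x n \<in> A \<longleftrightarrow> x (Suc n) \<in> {u \<in> V (Suc n). \<phi> (Suc n) u \<in> A}" if "x \<in> X" for x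
    using X_coord(1)[OF that, of "Suc n"] X_coord(2)[OF that, of n] by simp
  then show ?thesis
    unfolding cyl_def by blast
qed

text \<open>
  The next point is built one level up: its coordinate \<open>n\<close> is the image of any successor of the
  present coordinate \<open>n + 1\<close>, and directionality makes the choice of successor irrelevant.
\<close>

lemma F_props:
  assumes x: "x \<in> X"
  shows F_in_X: "F x \<in> X" and F_arc: "(x n, F x n) \<in> parcs (G n)"
proof -
  define y where "y n = \<phi> (Suc n) (SOME w. (x (Suc n), w) \<in> parcs (G (Suc n)))" for n
  have some: "(x n, SOME w. (x n, w) \<in> parcs (G n)) \<in> parcs (G n)" for n
    by (rule someI_ex) (use ex_out_arc X_coord(1)[OF x] in blast)
  have arc: "(x n, y n) \<in> parcs (G n)" for n
    using \<phi>_arc[OF some[of "Suc n"]] X_coord(2)[OF x, of n] by (simp add: y_def)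
  have y: "y \<in> X"
    unfolding inv_limit_def
  proof (intro CollectI allI conjI)
    fix n
    show "y n \<in> V n"
      using arc arc_in_V by blast
    show "y n = \<phi> (Suc n) (y (Suc n))"
      using \<phi>_directional[OF some[of "Suc n"] arc[of "Suc n"]] by (simp add: y_def)
  qed
  have "F x = y"
    unfolding inv_limit_map_def
  proof (rule the_equality)
    fix z assume z: "z \<in> X \<and> (\<forall>n. (x n, z n) \<in> parcs (G n))"
    then have zX: "z \<in> X" and z_arc: "(x n, z n) \<in> parcs (G n)" for n
      by auto
    show "z = y"
    proof
      fix n
      show "z n = y n"
        using \<phi>_directional[OF z_arc[of "Suc n"] arc[of "Suc n"]]
          X_coord(2)[OF y, of n] X_coord(2)[OF zX, of n] by simp
    qed
  qed (use y arc in blast)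
  then show "F x \<in> X" "(x n, F x n) \<in> parcs (G n)"
    using y arc by simp_all
qed

lemma F_coord:
  assumes "x \<in> X" "(x (Suc n), w) \<in> parcs (G (Suc n))"
  shows "F x n = \<phi> (Suc n) w"
proof -
  have "F x n = \<phi> (Suc n) (F x (Suc n))"
    by (rule X_coord(2)[OF F_in_X[OF assms(1)], symmetric])
  also have "\<dots> = \<phi> (Suc n) w"
    by (rule \<phi>_directional[OF F_arc[OF assms(1)] assms(2)])
  finally show ?thesis .
qed

lemma F_vimage_cyl: "F -` cyl n A \<inter> X = cyl (Suc n) (shift_fibre n A)"
proof -
  have "F x n \<in> A \<longleftrightarrow> x (Suc n) \<in> shift_fibre n A" if x: "x \<in> X" for x
  proof
    assume A: "F x n \<in> A"
    have "\<phi> (Suc n) (F x (Suc n)) \<in> A"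
      using A X_coord(2)[OF F_in_X[OF x], of n] by simp
    then show "x (Suc n) \<in> shift_fibre n A"
      using F_arc[OF x, of "Suc n"] X_coord(1)[OF x, of "Suc n"]
      unfolding shift_fibre_def by blast
  next
    assume "x (Suc n) \<in> shift_fibre n A"
    then obtain w where "(x (Suc n), w) \<in> parcs (G (Suc n))" "\<phi> (Suc n) w \<in> A"
      unfolding shift_fibre_def by blast
    then show "F x n \<in> A"
      using F_coord[OF x, of n w] by simp
  qed
  then show ?thesis
    using F_in_X unfolding cyl_def by blast
qed

lemma openin_cyl: "openin T (cyl n A)"
proof -
  let ?P = "product_topology (\<lambda>n. discrete_topology (V n)) UNIV"
  have "continuous_map ?P (discrete_topology (V n)) (\<lambda>x. x n)"
    by (rule continuous_map_product_projection) simp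
  then have "openin ?P {x \<in> topspace ?P. x n \<in> A \<inter> V n}"
    by (rule openin_continuous_map_preimage) simp
  moreover have "x \<in> topspace ?P \<and> x n \<in> V n" if "x \<in> X" for x
    using that by (auto intro: X_coord(1)[OF that])
  then have "cyl n A = {x \<in> topspace ?P. x n \<in> A \<inter> V n} \<inter> X"
    unfolding cyl_def by blast
  ultimately show ?thesis
    unfolding inv_limit_topology_def openin_subtopology by blast
qed

lemma closedin_cyl: "closedin T (cyl n A)"
proof -
  have "X - cyl n A = cyl n (- A)"
    by (auto simp: cyl_def)
  then show ?thesis
    using openin_cyl[of n "- A"] by (auto simp: closedin_def cyl_def)
qed

lemma openin_T_contains_cyl:
  assumes U: "openin T U" and x: "x \<in> U"
  shows "\<exists>n. cyl n {x n} \<subseteq> U"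
proof -
  let ?P = "product_topology (\<lambda>n. discrete_topology (V n)) UNIV"
  obtain W where W: "openin ?P W" "U = W \<inter> X"
    using U by (auto simp: inv_limit_topology_def openin_subtopology)
  then obtain B where B: "finite {i. B i \<noteq> V i}" "x \<in> Pi\<^sub>E UNIV B" "Pi\<^sub>E UNIV B \<subseteq> W"
    using x by (fastforce simp: openin_product_topology_alt)
  obtain n where n: "\<And>i. B i \<noteq> V i \<Longrightarrow> i \<le> n"
    using B(1) by (auto simp: finite_nat_set_iff_bounded_le)
  have "z \<in> U" if z: "z \<in> cyl n {x n}" for z
  proof -
    have zX: "z \<in> X" and "z n = x n"
      using z by (auto simp: cyl_def)
    have "z i \<in> B i" for i
    proof (cases "B i = V i")
      case False
      then have "z i = x i"
        using X_coord_eq[of z x n i] zX \<open>z n = x n\<close> n[of i] x W(2) by blast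
      then show ?thesis
        using B(2) by auto
    qed (use X_coord(1)[OF zX] in simp)
    then show ?thesis
      using B(3) W(2) zX by auto
  qed
  then show ?thesis
    by blast
qed

text \<open>
  An open set is the union over \<open>n\<close> of the largest cylinder of level \<open>n\<close> inside it, a countable union.
\<close>

lemma sets_top_borel_cyl: "sets (top_borel T) = sigma_sets X {cyl n A | n A. True}"
proof
  show "sigma_sets X {cyl n A | n A. True} \<subseteq> sets (top_borel T)"
    unfolding sets_top_borel topspace_T by (rule sigma_sets_mono') (auto simp: openin_cyl)
  show "sets (top_borel T) \<subseteq> sigma_sets X {cyl n A | n A. True}"
    unfolding sets_top_borel topspace_T
  proof (rule sigma_sets_mono, rule subsetI)
    fix U assume "U \<in> {U. openin T U}"
    then have U: "openin T U"
      by simp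
    then have "U \<subseteq> X"
      using openin_subset[OF U] by simp
    have "U = (\<Union>n. cyl n {v. cyl n {v} \<subseteq> U})"
    proof (intro equalityI subsetI)
      fix x assume "x \<in> U"
      then show "x \<in> (\<Union>n. cyl n {v. cyl n {v} \<subseteq> U})"
        using openin_T_contains_cyl[OF U] \<open>U \<subseteq> X\<close> by (fastforce simp: cyl_def)
    next
      fix x assume "x \<in> (\<Union>n. cyl n {v. cyl n {v} \<subseteq> U})"
      then show "x \<in> U"
        by (auto simp: cyl_def)
    qed
    moreover have "(\<Union>n. cyl n {v. cyl n {v} \<subseteq> U}) \<in> sigma_sets X {cyl n A | n A. True}"
      by (rule sigma_sets.Union) auto
    ultimately show "U \<in> sigma_sets X {cyl n A | n A. True}"
      by simp
  qed
qed

lemma cyl_in_sets: "cyl n A \<in> sets (top_borel T)"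
  unfolding sets_top_borel_cyl by (rule sigma_sets.Basic) blast

lemma compact_space_T: "compact_space T"
proof -
  let ?P = "product_topology (\<lambda>n. discrete_topology (V n)) UNIV"
  have "compact_space ?P"
    by (simp add: compact_space_product_topology compact_space_discrete_topology finite_V)
  have "closedin ?P {x \<in> topspace ?P. x n = \<phi> (Suc n) (x (Suc n))}" for n
  proof (rule closedin_continuous_maps_eq)
    show "Hausdorff_space (discrete_topology (V n))"
      by simp
    show "continuous_map ?P (discrete_topology (V n)) (\<lambda>x. x n)"
      by (rule continuous_map_product_projection) simp
    have "continuous_map ?P (discrete_topology (V (Suc n))) (\<lambda>x. x (Suc n))"
      by (rule continuous_map_product_projection) simp
    moreover have "continuous_map (discrete_topology (V (Suc n))) (discrete_topology (V n)) (\<phi> (Suc n))"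
      using \<phi>_in_V by auto
    ultimately show "continuous_map ?P (discrete_topology (V n)) (\<lambda>x. \<phi> (Suc n) (x (Suc n)))"
      by (rule continuous_map_compose[unfolded o_def])
  qed
  then have "closedin ?P (\<Inter>n. {x \<in> topspace ?P. x n = \<phi> (Suc n) (x (Suc n))})"
    by blast
  moreover have "(\<Inter>n. {x \<in> topspace ?P. x n = \<phi> (Suc n) (x (Suc n))}) = X"
    unfolding inv_limit_def topspace_product_topology PiE_UNIV_domain topspace_discrete_topology Pi_iff
    by blast
  ultimately have "closedin ?P X"
    by simp
  then show ?thesis
    unfolding inv_limit_topology_def
    using \<open>compact_space ?P\<close> closedin_compact_space compact_space_subtopology by blast
qed

lemma cyl_lift_le: "n \<le> m \<Longrightarrow> \<exists>B. cyl n A = cyl m B"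
proof (induction rule: dec_induct)
  case (step m)
  then obtain B where "cyl n A = cyl m B"
    by blast
  with cyl_lift[of m B] show ?case
    by (metis (no_types))
qed blast

lemma cyl_common_level: "\<exists>k A' B'. cyl n A = cyl k A' \<and> cyl m B = cyl k B'"
  using cyl_lift_le[OF max.cobounded1, of n A m] cyl_lift_le[OF max.cobounded2, of m B n] by blast

lemma cyl_Int: "cyl n A \<inter> cyl n B = cyl n (A \<inter> B)"
  and cyl_Un: "cyl n A \<union> cyl n B = cyl n (A \<union> B)"
  and cyl_Compl: "X - cyl n A = cyl n (- A)"
  by (auto simp: cyl_def)

lemma Int_stable_cyl: "Int_stable {cyl n A | n A. True}"
proof (rule Int_stableI)
  fix S S' assume "S \<in> {cyl n A | n A. True}" "S' \<in> {cyl n A | n A. True}"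
  then obtain n A m B where "S = cyl n A" "S' = cyl m B"
    by blast
  moreover obtain k A' B' where "cyl n A = cyl k A'" "cyl m B = cyl k B'"
    using cyl_common_level by blast
  ultimately show "S \<inter> S' \<in> {cyl n A | n A. True}"
    using cyl_Int[of k A' B'] by auto
qed

lemma measure_eqI_cyl:
  assumes "sets M = sets (top_borel T)" "sets N = sets (top_borel T)" "finite_measure M"
    and eq: "\<And>n A. emeasure M (cyl n A) = emeasure N (cyl n A)"
  shows "M = N"
proof (rule measure_eqI_generator_eq[OF Int_stable_cyl, where \<Omega> = X and A = "\<lambda>_. cyl 0 UNIV"])
  show "{cyl n A | n A. True} \<subseteq> Pow X"
    unfolding cyl_def by blast
  show "sets M = sigma_sets X {cyl n A | n A. True}" "sets N = sigma_sets X {cyl n A | n A. True}"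
    using assms(1,2) sets_top_borel_cyl by simp_all
  show "(\<Union>i::nat. cyl 0 UNIV) = X"
    unfolding cyl_def by simp
  show "emeasure M (cyl 0 UNIV) \<noteq> \<infinity>"
    using finite_measure.emeasure_finite[OF assms(3)] by simp
qed (use eq in blast)+

lemma F_measurable: "F \<in> top_borel T \<rightarrow>\<^sub>M top_borel T"
proof (rule measurableI)
  fix x assume "x \<in> space (top_borel T)"
  then show "F x \<in> space (top_borel T)"
    using F_in_X by simp
next
  fix S assume "S \<in> sets (top_borel T)"
  then have "S \<in> sigma_sets X {cyl n A | n A. True}"
    by (simp add: sets_top_borel_cyl)
  then show "F -` S \<inter> space (top_borel T) \<in> sets (top_borel T)"
  proof induction
    case (Basic S)
    then show ?case
      using F_vimage_cyl cyl_in_sets by auto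
  next
    case (Compl S)
    have "F -` (X - S) \<inter> X = X - (F -` S \<inter> X)"
      using F_in_X by auto
    then show ?case
      using sets.compl_sets[OF Compl.IH] by simp
  next
    case (Union S)
    have "F -` (\<Union>i. S i) \<inter> X = (\<Union>i. F -` S i \<inter> X)"
      by auto
    moreover have "(\<Union>i. F -` S i \<inter> X) \<in> sets (top_borel T)"
      using Union.IH by (intro sets.countable_UN) auto
    ultimately show ?case
      by simp
  qed simp
qed

section \<open>Borel measures on the inverse limit\<close>

text \<open>
  Weights on vertices that are consistent along the covering maps form a finitely additive set
  function on the algebra of cylinders.  Cylinders are compact, so a decreasing sequence of them with
  empty intersection reaches the empty set; this is continuity at the empty set, and Caratheodory's
  theorem extends the set function to a measure.
\<close>

lemma ex_borel_prob_with_weights: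
  fixes w :: "nat \<Rightarrow> 'v \<Rightarrow> real"
  assumes w_nonneg: "\<And>n v. v \<in> V n \<Longrightarrow> 0 \<le> w n v"
    and w_total: "(\<Sum>v\<in>V 0. w 0 v) = 1"
    and w_fibre: "\<And>n v. v \<in> V n \<Longrightarrow> (\<Sum>u \<in> {u \<in> V (Suc n). \<phi> (Suc n) u = v}. w (Suc n) u) = w n v"
  shows "\<exists>\<mu>. sets \<mu> = sets (top_borel T) \<and> prob_space \<mu> \<and>
           (\<forall>n A. emeasure \<mu> (cyl n A) = ennreal (\<Sum>v \<in> A \<inter> V n. w n v))"
proof -
  let ?C = "{cyl n A | n A. True}"
  define W where "W n S = (\<Sum>v \<in> (\<lambda>x. x n) ` S. w n v)" for n S
  define level where "level n S \<longleftrightarrow> (\<exists>A. S = cyl n A)" for n S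
  have W_cyl: "W n (cyl n A) = (\<Sum>v \<in> A \<inter> V n. w n v)" for n A
    by (simp add: W_def proj_cyl)
  have step: "level (Suc n) S \<and> W (Suc n) S = W n S" if "level n S" for n S
  proof -
    obtain A where S: "S = cyl n A"
      using \<open>level n S\<close> by (auto simp: level_def)
    let ?B = "{u \<in> V (Suc n). \<phi> (Suc n) u \<in> A}"
    have SB: "S = cyl (Suc n) ?B"
      unfolding S by (rule cyl_lift)
    have fin: "finite ?B" "finite (A \<inter> V n)"
      using finite_V[of n] finite_V[of "Suc n"] by auto
    have sub: "\<phi> (Suc n) ` ?B \<subseteq> A \<inter> V n"
      using \<phi>_in_V by auto
    have "W (Suc n) S = (\<Sum>u \<in> ?B. w (Suc n) u)"
      unfolding SB W_cyl by (rule sum.cong) auto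
    also have "\<dots> = (\<Sum>v \<in> A \<inter> V n. \<Sum>u \<in> {u \<in> ?B. \<phi> (Suc n) u = v}. w (Suc n) u)"
      using sum.group[OF fin sub, of "w (Suc n)"] by simp
    also have "\<dots> = (\<Sum>v \<in> A \<inter> V n. w n v)"
    proof (rule sum.cong)
      fix v assume v: "v \<in> A \<inter> V n"
      then have "{u \<in> ?B. \<phi> (Suc n) u = v} = {u \<in> V (Suc n). \<phi> (Suc n) u = v}"
        by auto
      then show "(\<Sum>u \<in> {u \<in> ?B. \<phi> (Suc n) u = v}. w (Suc n) u) = w n v"
        using w_fibre[of v n] v by simp
    qed simp
    also have "\<dots> = W n S"
      by (simp add: S W_cyl)
    finally have "W (Suc n) S = W n S" .
    moreover have "level (Suc n) S"
      using SB unfolding level_def by blast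
    ultimately show ?thesis
      by blast
  qed
  have up: "level m S \<and> W m S = W n S" if "level n S" "n \<le> m" for n m S
    using \<open>n \<le> m\<close>
  proof (induction rule: dec_induct)
    case base
    then show ?case
      using \<open>level n S\<close> by simp
  next
    case (step k)
    then show ?case
      using \<open>\<And>n S. level n S \<Longrightarrow> level (Suc n) S \<and> W (Suc n) S = W n S\<close>[of k S] by simp
  qed
  \<comment> \<open>The value is read off at any level that sees the set; the least one is only a canonical choice.\<close>
  define m where "m S = W (LEAST n. level n S) S" for S
  have m_eq: "m S = W n S" if "level n S" for n S
    unfolding m_def using up[OF LeastI[of "\<lambda>n. level n S", OF that] Least_le[of "\<lambda>n. level n S", OF that]]
    by simp
  have m_cyl: "m (cyl n A) = (\<Sum>v \<in> A \<inter> V n. w n v)" for n A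
    using m_eq[of n "cyl n A"] W_cyl by (auto simp: level_def)
  have m_nonneg: "0 \<le> m (cyl n A)" for n A
    unfolding m_cyl by (rule sum_nonneg) (use w_nonneg in auto)
  have m_empty: "m {} = 0"
    using m_cyl[of 0 "{}"] by (simp add: cyl_def)
  have algebra: "algebra X ?C"
    unfolding algebra_iff_Un
  proof (intro conjI ballI)
    show "?C \<subseteq> Pow X"
      by (auto simp: cyl_def)
    have "cyl 0 {} = {}"
      by (simp add: cyl_def)
    then show "{} \<in> ?C"
      by blast
  next
    fix S assume "S \<in> ?C"
    then show "X - S \<in> ?C"
      using cyl_Compl by blast
  next
    fix S S' assume "S \<in> ?C" "S' \<in> ?C"
    then obtain n A k B where "S = cyl n A" "S' = cyl k B"
      by blast
    moreover obtain j A' B' where "cyl n A = cyl j A'" "cyl k B = cyl j B'"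
      using cyl_common_level by blast
    ultimately show "S \<union> S' \<in> ?C"
      using cyl_Un[of j A' B'] by auto
  qed
  interpret algebra X ?C
    by (rule algebra)
  have "\<exists>\<mu> :: (nat \<Rightarrow> 'v) set \<Rightarrow> ennreal. (\<forall>S\<in>?C. \<mu> S = ennreal (m S)) \<and> measure_space X (sigma_sets X ?C) \<mu>"
  proof (rule caratheodory_empty_continuous)
    show "positive ?C (\<lambda>S. ennreal (m S))"
      by (simp add: positive_def m_empty)
    show "additive ?C (\<lambda>S. ennreal (m S))"
      unfolding additive_def
    proof (intro ballI impI)
      fix S S' assume "S \<in> ?C" "S' \<in> ?C" and dis: "S \<inter> S' = {}"
      then obtain n A k B where S0: "S = cyl n A" "S' = cyl k B"
        by blast
      obtain j A' B' where "cyl n A = cyl j A'" "cyl k B = cyl j B'"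
        using cyl_common_level by blast
      then have S: "S = cyl j A'" "S' = cyl j B'"
        using S0 by auto
      have "(A' \<inter> V j) \<inter> (B' \<inter> V j) = {}"
        using proj_cyl[of j "A' \<inter> B'"] dis by (auto simp: S cyl_Int)
      then have "(\<Sum>v \<in> (A' \<inter> V j) \<union> (B' \<inter> V j). w j v) = m S + m S'"
        unfolding S m_cyl using finite_V by (intro sum.union_disjoint) auto
      moreover have "m (S \<union> S') = (\<Sum>v \<in> (A' \<inter> V j) \<union> (B' \<inter> V j). w j v)"
        unfolding S cyl_Un m_cyl Int_Un_distrib2 ..
      moreover have "0 \<le> m S" "0 \<le> m S'"
        unfolding S by (rule m_nonneg)+
      ultimately show "ennreal (m (S \<union> S')) = ennreal (m S) + ennreal (m S')"
        by (simp only: ennreal_plus)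
    qed
    show "\<And>S. S \<in> ?C \<Longrightarrow> ennreal (m S) \<noteq> \<infinity>"
      by simp
    fix S :: "nat \<Rightarrow> (nat \<Rightarrow> 'v) set"
    assume S: "range S \<subseteq> ?C" "decseq S" "(\<Inter>i. S i) = {}"
    have "\<exists>i. S i = {}"
    proof (rule ccontr)
      assume "\<nexists>i. S i = {}"
      moreover have "closedin T (S i)" for i
      proof -
        have "S i \<in> ?C"
          using S(1) by (rule subsetD) (rule rangeI)
        then obtain n A where "S i = cyl n A"
          by blast
        then show ?thesis
          using closedin_cyl by simp
      qed
      ultimately have "(\<Inter>i. S i) \<noteq> {}"
        using compact_space_imp_nest[OF compact_space_T, of S] S(2) by blast
      then show False
        using S(3) by simp
    qed
    then obtain i where "S i = {}"
      by blast
    then have "S j = {}" if "j \<ge> i" for j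
      using S(2) that by (auto simp: decseq_def)
    then have "\<forall>\<^sub>F j in sequentially. ennreal (m (S j)) = 0"
      unfolding eventually_sequentially using m_empty by (intro exI[of _ i]) auto
    then show "(\<lambda>i. ennreal (m (S i))) \<longlonglongrightarrow> 0"
      by (rule tendsto_eventually)
  qed
  then obtain \<mu> :: "(nat \<Rightarrow> 'v) set \<Rightarrow> ennreal"
    where \<mu>: "\<And>S. S \<in> ?C \<Longrightarrow> \<mu> S = ennreal (m S)" and ms: "measure_space X (sigma_sets X ?C) \<mu>"
    by blast
  define M where "M = measure_of X ?C \<mu>"
  have sets_M: "sets M = sigma_sets X ?C"
    unfolding M_def by (rule sets_measure_of) (use space_closed in blast)
  have em: "emeasure M (cyl n A) = ennreal (\<Sum>v \<in> A \<inter> V n. w n v)" for n A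
  proof -
    have "emeasure M (cyl n A) = \<mu> (cyl n A)"
    proof (rule emeasure_measure_of[OF M_def])
      show "?C \<subseteq> Pow X"
        by (rule space_closed)
      show "positive (sets M) \<mu>" "countably_additive (sets M) \<mu>"
        using ms by (auto simp: sets_M measure_space_def)
      show "cyl n A \<in> sets M"
        unfolding sets_M by (rule sigma_sets.Basic) blast
    qed
    also have "\<dots> = ennreal (m (cyl n A))"
      by (rule \<mu>) blast
    finally show ?thesis
      by (simp add: m_cyl)
  qed
  have "space M = cyl 0 UNIV"
    using sets_eq_imp_space_eq[of M "top_borel T"] by (simp add: sets_M sets_top_borel_cyl cyl_def)
  then have "prob_space M"
    using em[of 0 UNIV] w_total by (intro prob_spaceI) simp
  then show ?thesis
    using em sets_M sets_top_borel_cyl by auto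
qed

lemma measure_cyl_sum:
  assumes "finite_measure M" "sets M = sets (top_borel T)"
  shows "measure M (cyl n A) = (\<Sum>v \<in> A \<inter> V n. measure M (cyl n {v}))"
proof -
  interpret finite_measure M
    by fact
  have "x n \<in> V n" if "x \<in> X" for x
    by (rule X_coord(1)[OF that])
  then have "cyl n A = (\<Union>v \<in> A \<inter> V n. cyl n {v})"
    unfolding cyl_def by blast
  moreover have "measure M (\<Union>v \<in> A \<inter> V n. cyl n {v}) = (\<Sum>v \<in> A \<inter> V n. measure M (cyl n {v}))"
  proof (rule finite_measure_finite_Union)
    show "finite (A \<inter> V n)"
      using finite_V by blast
    show "(\<lambda>v. cyl n {v}) ` (A \<inter> V n) \<subseteq> sets M"
      using assms(2) cyl_in_sets by auto
    show "disjoint_family_on (\<lambda>v. cyl n {v}) (A \<inter> V n)"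
      by (auto simp: disjoint_family_on_def cyl_def)
  qed
  ultimately show ?thesis
    by simp
qed

text \<open>
  For probability measures, the mass of one distinguished vertex per level is what the others leave,
  so it need not be compared.  Level 0 is covered by lifting to level 1.
\<close>

lemma prob_measure_eqI_cyl:
  assumes M: "prob_space M" "sets M = sets (top_borel T)"
    and N: "prob_space N" "sets N = sets (top_borel T)"
    and eq: "\<And>n v. \<lbrakk>v \<in> V (Suc n); v \<noteq> p (Suc n)\<rbrakk> \<Longrightarrow> measure M (cyl (Suc n) {v}) = measure N (cyl (Suc n) {v})"
  shows "M = N"
proof -
  have fM: "finite_measure M" and fN: "finite_measure N"
    using M(1) N(1) by (simp_all add: prob_space_def)
  have spM: "space M = X" and spN: "space N = X"
    using sets_eq_imp_space_eq[OF M(2)] sets_eq_imp_space_eq[OF N(2)] by simp_all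
  have off: "measure M (cyl (Suc n) A) = measure N (cyl (Suc n) A)" if "p (Suc n) \<notin> A" for n A
    unfolding measure_cyl_sum[OF fM M(2), of "Suc n" A] measure_cyl_sum[OF fN N(2), of "Suc n" A]
    using that eq by (intro sum.cong) auto
  have on: "measure M (cyl (Suc n) A) = measure N (cyl (Suc n) A)" for n A
  proof (cases "p (Suc n) \<in> A")
    case True
    have "measure M (X - cyl (Suc n) (- A)) = measure N (X - cyl (Suc n) (- A))"
      using prob_space.prob_compl[OF M(1), of "cyl (Suc n) (- A)"] prob_space.prob_compl[OF N(1), of "cyl (Suc n) (- A)"]
        off[of n "- A"] True M(2) N(2) spM spN cyl_in_sets by simp
    then show ?thesis
      by (simp add: cyl_Compl)
  qed (rule off)
  have "emeasure M (cyl n A) = emeasure N (cyl n A)" for n A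
  proof -
    obtain B where B: "cyl n A = cyl (Suc n) B"
      using cyl_lift[of n A] by blast
    have "measure M (cyl n A) = measure N (cyl n A)"
      unfolding B by (rule on)
    then show ?thesis
      by (simp add: finite_measure.emeasure_eq_measure[OF fM] finite_measure.emeasure_eq_measure[OF fN])
  qed
  then show "M = N"
    by (rule measure_eqI_cyl[OF M(2) N(2) fM])
qed

lemma invariant_borel_probI:
  assumes s: "sets \<mu> = sets (top_borel T)" and p: "prob_space \<mu>"
    and inv: "\<And>n v. \<lbrakk>v \<in> V (Suc n); v \<noteq> q (Suc n)\<rbrakk> \<Longrightarrow>
       measure \<mu> (cyl (Suc (Suc n)) (shift_fibre (Suc n) {v})) = measure \<mu> (cyl (Suc n) {v})"
  shows "invariant_borel_prob T F \<mu>"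
proof -
  have sp: "space \<mu> = X"
    using sets_eq_imp_space_eq[OF s] by simp
  have Fm: "F \<in> \<mu> \<rightarrow>\<^sub>M \<mu>"
    using F_measurable measurable_cong_sets[OF s s] by blast
  have "distr \<mu> \<mu> F = \<mu>"
  proof (rule prob_measure_eqI_cyl[where p = q])
    show "prob_space (distr \<mu> \<mu> F)"
      by (rule prob_space.prob_space_distr[OF p Fm])
    fix n v assume "v \<in> V (Suc n)" "v \<noteq> q (Suc n)"
    then show "measure (distr \<mu> \<mu> F) (cyl (Suc n) {v}) = measure \<mu> (cyl (Suc n) {v})"
      using measure_distr[OF Fm, of "cyl (Suc n) {v}"] inv[of v n] cyl_in_sets
      by (simp add: s sp F_vimage_cyl)
  qed (use s p in simp_all)
  then show ?thesis
    using s p F_measurable by (simp add: invariant_borel_prob_altdef)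
qed

lemma invariant_borel_prob_vimage:
  assumes inv: "invariant_borel_prob T F \<mu>" and S: "S \<in> sets (top_borel T)"
  shows "measure \<mu> (F -` S \<inter> X) = measure \<mu> S"
proof -
  have s: "sets \<mu> = sets (top_borel T)" and d: "distr \<mu> \<mu> F = \<mu>"
    using inv by (auto simp: invariant_borel_prob_altdef)
  have Fm: "F \<in> \<mu> \<rightarrow>\<^sub>M \<mu>"
    using F_measurable measurable_cong_sets[OF s s] by blast
  have "space \<mu> = X"
    using sets_eq_imp_space_eq[OF s] by simp
  then show ?thesis
    using measure_distr[OF Fm, of S] S s d by simp
qed

end

section \<open>Coverings by a loop and one long circuit\<close>

text \<open>
  The combinatorics that governs invariant measures.  The walk \<open>c n\<close> is the long circuit; as a list it
  has both ends at the center, so its noncentral vertices are at the positions \<open>1, \<dots>, l n - 1\<close>.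
  The assumption \<open>\<phi>_c_1\<close> says that the image of \<open>c (Suc n)\<close> starts with the loop, and \<open>winding\<close> that it
  runs \<open>b n\<close> times around \<open>c n\<close>.
\<close>

locale figure_eight_covering = graph_covering G \<phi>
  for G :: "nat \<Rightarrow> 'v pair_pre_digraph" and \<phi> +
  fixes ctr :: "nat \<Rightarrow> 'v" and c :: "nat \<Rightarrow> 'v list" and l b :: "nat \<Rightarrow> nat"
  assumes V_0: "V 0 = {ctr 0}"
    and \<phi>_ctr: "\<phi> (Suc n) (ctr (Suc n)) = ctr n"
    and l_ge_2: "n \<ge> 1 \<Longrightarrow> l n \<ge> 2"
    and arcs_eq: "n \<ge> 1 \<Longrightarrow> parcs (G n) = insert (ctr n, ctr n) {(c n ! i, c n ! Suc i) | i. i < l n}"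
    and c_0: "n \<ge> 1 \<Longrightarrow> c n ! 0 = ctr n" and c_l: "n \<ge> 1 \<Longrightarrow> c n ! l n = ctr n"
    and c_inj: "n \<ge> 1 \<Longrightarrow> inj_on ((!) (c n)) {..<l n}"
    and \<phi>_c_1: "n \<ge> 1 \<Longrightarrow> \<phi> (Suc n) (c (Suc n) ! 1) = ctr n"
    and b_ge_1: "n \<ge> 1 \<Longrightarrow> b n \<ge> 1"
    and winding: "\<lbrakk>n \<ge> 1; v \<in> V n; v \<noteq> ctr n\<rbrakk> \<Longrightarrow>
                    card {j \<in> {1..<l (Suc n)}. \<phi> (Suc n) (c (Suc n) ! j) = v} = b n"
begin

lemma V_eq:
  assumes n: "n \<ge> 1"
  shows "V n = (!) (c n) ` {..<l n}"
proof
  show "V n \<subseteq> (!) (c n) ` {..<l n}"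
  proof
    fix v assume "v \<in> V n"
    then obtain w where "(v, w) \<in> parcs (G n)"
      using ex_out_arc by blast
    then consider "v = ctr n" | i where "i < l n" "v = c n ! i"
      unfolding arcs_eq[OF n] by blast
    then show "v \<in> (!) (c n) ` {..<l n}"
    proof cases
      case 1
      then show ?thesis
        using c_0[OF n] l_ge_2[OF n] by (intro image_eqI[of _ _ 0]) auto
    qed blast
  qed
  have "(c n ! i, c n ! Suc i) \<in> parcs (G n)" if "i < l n" for i
    unfolding arcs_eq[OF n] using that by blast
  then show "(!) (c n) ` {..<l n} \<subseteq> V n"
    using arc_in_V by blast
qed

lemma c_ne_ctr:
  assumes n: "n \<ge> 1" and i: "1 \<le> i" "i < l n"
  shows "c n ! i \<noteq> ctr n"
  using inj_onD[OF c_inj[OF n], of i 0] c_0[OF n] i by auto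

lemma noncentral_eq:
  assumes n: "n \<ge> 1"
  shows "V n - {ctr n} = (!) (c n) ` {1..<l n}"
proof -
  have "{..<l n} = insert 0 {1..<l n}"
    using l_ge_2[OF n] by auto
  then show ?thesis
    using V_eq[OF n] c_0[OF n] c_ne_ctr[OF n] by auto
qed

lemma card_noncentral:
  assumes n: "n \<ge> 1"
  shows "card (V n - {ctr n}) = l n - 1"
proof -
  have "inj_on ((!) (c n)) {1..<l n}"
    by (rule inj_on_subset[OF c_inj[OF n]]) auto
  then show ?thesis
    unfolding noncentral_eq[OF n] by (simp add: card_image)
qed

lemma ctr_in_V: "ctr n \<in> V n"
proof (cases "n \<ge> 1")
  case True
  then show ?thesis
    using V_eq[OF True] c_0[OF True] l_ge_2[OF True] by (auto intro!: image_eqI[of _ _ 0])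
next
  case False
  then have "n = 0"
    by simp
  then show ?thesis
    using V_0 by simp
qed

lemma ctr_in_X: "ctr \<in> X"
  unfolding inv_limit_def using ctr_in_V \<phi>_ctr by simp

text \<open>
  The fibre of a noncentral vertex avoids the center, so it consists of positions on the long circuit
  and is counted by the winding number \<open>b n\<close>.
\<close>

lemma fibre_noncentral:
  assumes n: "n \<ge> 1" and v: "v \<in> V n" "v \<noteq> ctr n"
  shows "{u \<in> V (Suc n). \<phi> (Suc n) u = v} \<subseteq> V (Suc n) - {ctr (Suc n)}"
    and "card {u \<in> V (Suc n). \<phi> (Suc n) u = v} = b n"
proof -
  let ?J = "{j \<in> {1..<l (Suc n)}. \<phi> (Suc n) (c (Suc n) ! j) = v}"
  show sub: "{u \<in> V (Suc n). \<phi> (Suc n) u = v} \<subseteq> V (Suc n) - {ctr (Suc n)}"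
    using \<phi>_ctr[of n] v(2) by blast
  have "{u \<in> V (Suc n). \<phi> (Suc n) u = v} = {u \<in> V (Suc n) - {ctr (Suc n)}. \<phi> (Suc n) u = v}"
    using sub by blast
  also have "\<dots> = (!) (c (Suc n)) ` ?J"
    using noncentral_eq[of "Suc n"] by auto
  finally have eq: "{u \<in> V (Suc n). \<phi> (Suc n) u = v} = (!) (c (Suc n)) ` ?J" .
  have "inj_on ((!) (c (Suc n))) ?J"
    by (rule inj_on_subset[OF c_inj]) auto
  then show "card {u \<in> V (Suc n). \<phi> (Suc n) u = v} = b n"
    unfolding eq using winding[OF n v] by (simp only: card_image)
qed

text \<open>
  Moving one step forward on the circuit is a bijection from the shifted fibre to the fibre: the image
  of the circuit is at the center at the positions 0, 1 and \<open>l (Suc n)\<close>, so no visit to a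
  noncentral vertex is lost or gained at the ends.
\<close>

lemma shift_fibre_noncentral:
  assumes n: "n \<ge> 1" and v: "v \<in> V n" "v \<noteq> ctr n"
  shows "shift_fibre n {v} \<subseteq> V (Suc n) - {ctr (Suc n)}"
    and "card (shift_fibre n {v}) = b n"
proof -
  let ?L = "l (Suc n)" and ?c = "c (Suc n)"
  let ?J = "{j \<in> {1..<?L}. \<phi> (Suc n) (?c ! j) = v}"
  let ?K = "{k \<in> {1..<?L}. \<phi> (Suc n) (?c ! Suc k) = v}"
  have arcs: "parcs (G (Suc n)) = insert (ctr (Suc n), ctr (Suc n)) {(?c ! i, ?c ! Suc i) | i. i < ?L}"
    by (rule arcs_eq) simp
  have eq: "shift_fibre n {v} = (!) ?c ` ?K"
  proof
    show "shift_fibre n {v} \<subseteq> (!) ?c ` ?K"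
    proof
      fix u assume "u \<in> shift_fibre n {v}"
      then obtain w where w: "(u, w) \<in> parcs (G (Suc n))" "\<phi> (Suc n) w = v"
        by (auto simp: shift_fibre_def)
      then have "(u, w) \<noteq> (ctr (Suc n), ctr (Suc n))"
        using \<phi>_ctr[of n] v(2) by auto
      then obtain i where i: "i < ?L" "u = ?c ! i" "w = ?c ! Suc i"
        using w(1) unfolding arcs by blast
      moreover have "i \<noteq> 0"
        using \<phi>_c_1[OF n] w(2) i(3) v(2) by (cases i) auto
      ultimately have "i \<in> ?K"
        using w(2) by simp
      then show "u \<in> (!) ?c ` ?K"
        using i(2) by blast
    qed
    show "(!) ?c ` ?K \<subseteq> shift_fibre n {v}"
    proof
      fix u assume "u \<in> (!) ?c ` ?K"
      then obtain k where k: "k \<in> ?K" "u = ?c ! k"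
        by blast
      then have "(u, ?c ! Suc k) \<in> parcs (G (Suc n))"
        unfolding arcs by auto
      then show "u \<in> shift_fibre n {v}"
        using k arc_in_V by (auto simp: shift_fibre_def)
    qed
  qed
  show "shift_fibre n {v} \<subseteq> V (Suc n) - {ctr (Suc n)}"
    unfolding eq noncentral_eq[of "Suc n", simplified] by auto
  have "?J = Suc ` ?K"
  proof
    show "?J \<subseteq> Suc ` ?K"
    proof
      fix j assume j: "j \<in> ?J"
      moreover have "j \<noteq> 1"
        using j \<phi>_c_1[OF n] v(2) by auto
      ultimately have "j - 1 \<in> ?K" "j = Suc (j - 1)"
        by auto
      then show "j \<in> Suc ` ?K"
        by blast
    qed
    have "Suc k \<noteq> ?L" if "k \<in> ?K" for k
      using that c_l[of "Suc n"] \<phi>_ctr[of n] v(2) by auto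
    then show "Suc ` ?K \<subseteq> ?J"
      by force
  qed
  then have "card ?J = card ?K"
    by (simp add: card_image)
  moreover have "inj_on ((!) ?c) ?K"
    by (rule inj_on_subset[OF c_inj]) auto
  ultimately show "card (shift_fibre n {v}) = b n"
    unfolding eq using winding[OF n v] by (simp only: card_image)
qed

section \<open>Invariant measures and heights\<close>

lemma c_1_noncentral: "n \<ge> 1 \<Longrightarrow> c n ! 1 \<in> V n - {ctr n}"
  unfolding noncentral_eq using l_ge_2[of n] by (intro imageI) simp

text \<open>
  The cylinder of a noncentral vertex and its preimage are both cylinders over noncentral vertices, so
  both miss the point \<open>ctr\<close>.
\<close>

lemma dirac_invariant: "invariant_borel_prob T F (return (top_borel T) ctr)"
proof (rule invariant_borel_probI[where q = ctr])
  show "prob_space (return (top_borel T) ctr)"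
    using ctr_in_X by (intro prob_space_return) simp
  fix n v assume v: "v \<in> V (Suc n)" "v \<noteq> ctr (Suc n)"
  have "ctr (Suc (Suc n)) \<notin> shift_fibre (Suc n) {v}"
    using shift_fibre_noncentral(1)[OF _ v] by auto
  then have "ctr \<notin> cyl (Suc (Suc n)) (shift_fibre (Suc n) {v})" "ctr \<notin> cyl (Suc n) {v}"
    using v(2) by (auto simp: cyl_def)
  then show "measure (return (top_borel T) ctr) (cyl (Suc (Suc n)) (shift_fibre (Suc n) {v})) =
      measure (return (top_borel T) ctr) (cyl (Suc n) {v})"
    by (simp add: measure_return cyl_in_sets)
qed simp

text \<open>
  The noncentral vertices of level \<open>n\<close> get weight \<open>m n\<close> and the center the rest.  Fibres and shifted
  fibres of noncentral vertices both consist of \<open>b n\<close> noncentral vertices; the first makes the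
  weights consistent and the second makes the measure invariant.
\<close>

lemma ex_invariant_with_heights:
  fixes m :: "nat \<Rightarrow> real"
  assumes m_nonneg: "\<And>n. n \<ge> 1 \<Longrightarrow> 0 \<le> m n"
    and m_total: "\<And>n. n \<ge> 1 \<Longrightarrow> real (l n - 1) * m n \<le> 1"
    and m_step: "\<And>n. n \<ge> 1 \<Longrightarrow> m n = real (b n) * m (Suc n)"
  shows "\<exists>\<mu>. invariant_borel_prob T F \<mu> \<and> measure \<mu> (cyl 1 {c 1 ! 1}) = m 1"
proof -
  define w where "w n v = (if n = 0 then 1 else if v = ctr n then 1 - real (l n - 1) * m n else m n)" for n v
  have w_off: "w n v = m n" if "n \<ge> 1" "v \<noteq> ctr n" for n v
    using that by (simp add: w_def)
  have total: "(\<Sum>v \<in> V n. w n v) = 1" for n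
  proof (cases "n \<ge> 1")
    case False
    then have "n = 0"
      by simp
    then show ?thesis
      using V_0 by (simp add: w_def)
  next
    case True
    have "(\<Sum>v \<in> V n. w n v) = w n (ctr n) + (\<Sum>v \<in> V n - {ctr n}. w n v)"
      using finite_V ctr_in_V by (rule sum.remove)
    also have "(\<Sum>v \<in> V n - {ctr n}. w n v) = (\<Sum>v \<in> V n - {ctr n}. m n)"
      using w_off[OF True] by (intro sum.cong) auto
    also have "w n (ctr n) + \<dots> = 1"
      using True by (simp add: w_def card_noncentral[OF True])
    finally show ?thesis .
  qed
  have sum_off: "(\<Sum>u \<in> B. w (Suc n) u) = m n"
    if "n \<ge> 1" "B \<subseteq> V (Suc n) - {ctr (Suc n)}" "card B = b n" for n B
  proof -
    have "(\<Sum>u \<in> B. w (Suc n) u) = (\<Sum>u \<in> B. m (Suc n))"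
      using that(2) w_off[of "Suc n"] by (intro sum.cong) auto
    then show ?thesis
      using that(3) m_step[OF that(1)] by simp
  qed
  have fibre: "(\<Sum>u \<in> {u \<in> V (Suc n). \<phi> (Suc n) u = v}. w (Suc n) u) = w n v" if v: "v \<in> V n" for n v
  proof -
    have off: "(\<Sum>u \<in> {u \<in> V (Suc n). \<phi> (Suc n) u = v'}. w (Suc n) u) = w n v'"
      if v': "v' \<in> V n - {ctr n}" for v'
    proof -
      have n: "n \<ge> 1"
        using v' V_0 by (cases n) auto
      show ?thesis
        using sum_off[OF n fibre_noncentral[OF n, of v']] v' w_off[OF n, of v'] by simp
    qed
    show ?thesis
    proof (cases "v = ctr n")
      case False
      then show ?thesis
        using off v by blast
    next
      case True
      \<comment> \<open>The fibre over the center takes what the other fibres leave of the total mass 1.\<close>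
      let ?S = "\<lambda>v. \<Sum>u \<in> {u \<in> V (Suc n). \<phi> (Suc n) u = v}. w (Suc n) u"
      have "\<phi> (Suc n) ` V (Suc n) \<subseteq> V n"
        using \<phi>_in_V by blast
      then have "(\<Sum>v \<in> V n. ?S v) = (\<Sum>v \<in> V n. w n v)"
        using sum.group[OF finite_V finite_V, of "\<phi> (Suc n)" "Suc n" n "w (Suc n)"] total by simp
      moreover have "(\<Sum>v \<in> V n. ?S v) = ?S (ctr n) + (\<Sum>v \<in> V n - {ctr n}. ?S v)"
        "(\<Sum>v \<in> V n. w n v) = w n (ctr n) + (\<Sum>v \<in> V n - {ctr n}. w n v)"
        using finite_V ctr_in_V by (rule sum.remove)+
      moreover have "(\<Sum>v \<in> V n - {ctr n}. ?S v) = (\<Sum>v \<in> V n - {ctr n}. w n v)"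
        using off by (rule sum.cong[OF refl])
      ultimately show ?thesis
        using True by simp
    qed
  qed
  have w_nonneg: "0 \<le> w n v" for n v
    using m_nonneg[of n] m_total[of n] by (simp add: w_def)
  then obtain \<mu> where s: "sets \<mu> = sets (top_borel T)" and p: "prob_space \<mu>"
    and em: "\<And>n A. emeasure \<mu> (cyl n A) = ennreal (\<Sum>v \<in> A \<inter> V n. w n v)"
    using ex_borel_prob_with_weights[of w, OF w_nonneg total fibre] by blast
  have meas: "measure \<mu> (cyl n A) = (\<Sum>v \<in> A. w n v)" if "A \<subseteq> V n" for n A
  proof -
    have "A \<inter> V n = A"
      using that by blast
    moreover have "0 \<le> (\<Sum>v \<in> A. w n v)"
      by (rule sum_nonneg) (rule w_nonneg)
    ultimately show ?thesis
      using em[of n A] by (simp add: measure_def)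
  qed
  have "invariant_borel_prob T F \<mu>"
  proof (rule invariant_borel_probI[OF s p, where q = ctr])
    fix n v assume v: "v \<in> V (Suc n)" "v \<noteq> ctr (Suc n)"
    have n: "Suc n \<ge> 1"
      by simp
    note sf = shift_fibre_noncentral[OF n v]
    have "measure \<mu> (cyl (Suc (Suc n)) (shift_fibre (Suc n) {v})) = m (Suc n)"
      using meas[of "shift_fibre (Suc n) {v}" "Suc (Suc n)"] sum_off[OF n sf] sf(1) by auto
    moreover have "measure \<mu> (cyl (Suc n) {v}) = m (Suc n)"
      using meas[of "{v}" "Suc n"] v w_off[OF n v(2)] by simp
    ultimately show "measure \<mu> (cyl (Suc (Suc n)) (shift_fibre (Suc n) {v})) = measure \<mu> (cyl (Suc n) {v})"
      by simp
  qed
  moreover have "c 1 ! 1 \<in> V 1 - {ctr 1}"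
    by (rule c_1_noncentral) simp
  then have "measure \<mu> (cyl 1 {c 1 ! 1}) = m 1"
    using meas[of "{c 1 ! 1}" 1] w_off[of 1 "c 1 ! 1"] by simp
  ultimately show ?thesis
    by blast
qed

context
  fixes \<mu> :: "(nat \<Rightarrow> 'v) measure"
  assumes inv: "invariant_borel_prob T F \<mu>"
begin

text \<open>
  A noncentral vertex past the first is entered only from its predecessor on the circuit, and a
  noncentral predecessor leads only to it.  So the cylinder of the predecessor is the preimage
  of its cylinder.
\<close>

lemma measure_noncentral:
  assumes n: "n \<ge> 1" and v: "v \<in> V n" "v \<noteq> ctr n"
  shows "measure \<mu> (cyl n {v}) = measure \<mu> (cyl n {c n ! 1})"
proof -
  have eq: "measure \<mu> (cyl n {c n ! i}) = measure \<mu> (cyl n {c n ! 1})" if "1 \<le> i" "i < l n" for i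
    using that
  proof (induction i rule: dec_induct)
    case (step i)
    have "F x n = c n ! Suc i \<longleftrightarrow> x n = c n ! i" if x: "x \<in> X" for x
    proof
      assume Fx: "F x n = c n ! Suc i"
      have "(x n, c n ! Suc i) \<in> parcs (G n)"
        using F_arc[OF x, of n] Fx by simp
      moreover have ne: "c n ! Suc i \<noteq> ctr n"
        using c_ne_ctr[OF n, of "Suc i"] step by simp
      ultimately obtain k where k: "x n = c n ! k" "c n ! Suc i = c n ! Suc k" "k < l n"
        unfolding arcs_eq[OF n] by blast
      have "Suc k \<noteq> l n"
        using ne k(2) c_l[OF n] by metis
      then have "Suc i = Suc k"
        using inj_onD[OF c_inj[OF n] k(2)] k(3) step by simp
      then show "x n = c n ! i"
        using k(1) by simp
    next
      assume xi: "x n = c n ! i"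
      have ne: "c n ! i \<noteq> ctr n"
        using c_ne_ctr[OF n, of i] step by simp
      have "(c n ! i, F x n) \<in> parcs (G n)"
        using F_arc[OF x, of n] xi by simp
      then obtain k where k: "c n ! i = c n ! k" "F x n = c n ! Suc k" "k < l n"
        using ne unfolding arcs_eq[OF n] by blast
      then have "i = k"
        using inj_onD[OF c_inj[OF n] k(1)] step by simp
      then show "F x n = c n ! Suc i"
        using k(2) by simp
    qed
    then have "F -` cyl n {c n ! Suc i} \<inter> X = cyl n {c n ! i}"
      using F_in_X unfolding cyl_def by blast
    then have "measure \<mu> (cyl n {c n ! Suc i}) = measure \<mu> (cyl n {c n ! i})"
      using invariant_borel_prob_vimage[OF inv cyl_in_sets[of n "{c n ! Suc i}"]] by simp
    then show ?case
      using step by simp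
  qed simp
  have "v \<in> (!) (c n) ` {1..<l n}"
    using v unfolding noncentral_eq[OF n, symmetric] by blast
  then obtain i where i: "i \<in> {1..<l n}" "v = c n ! i"
    by (rule imageE)
  show ?thesis
    unfolding i(2) by (rule eq) (use i(1) in simp_all)
qed

lemma measure_sum_noncentral:
  assumes n: "n \<ge> 1" and B: "B \<subseteq> V n - {ctr n}"
  shows "measure \<mu> (cyl n B) = real (card B) * measure \<mu> (cyl n {c n ! 1})"
proof -
  have "sets \<mu> = sets (top_borel T)" "finite_measure \<mu>"
    using inv by (auto simp: invariant_borel_prob_altdef prob_space_def)
  then have "measure \<mu> (cyl n B) = (\<Sum>v \<in> B \<inter> V n. measure \<mu> (cyl n {v}))"
    by (intro measure_cyl_sum)
  also have "\<dots> = (\<Sum>v \<in> B. measure \<mu> (cyl n {c n ! 1}))"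
    using B measure_noncentral[OF n] by (intro sum.cong) auto
  finally show ?thesis
    by simp
qed

lemma height_total:
  assumes n: "n \<ge> 1"
  shows "real (l n - 1) * measure \<mu> (cyl n {c n ! 1}) \<le> 1"
proof -
  have "prob_space \<mu>"
    using inv by (simp add: invariant_borel_prob_altdef)
  then have "measure \<mu> (cyl n (V n - {ctr n})) \<le> 1"
    by (rule prob_space.prob_le_1)
  then show ?thesis
    using measure_sum_noncentral[OF n subset_refl] card_noncentral[OF n] by simp
qed

lemma height_step:
  assumes n: "n \<ge> 1"
  shows "measure \<mu> (cyl n {c n ! 1}) = real (b n) * measure \<mu> (cyl (Suc n) {c (Suc n) ! 1})"
proof -
  have v: "c n ! 1 \<in> V n" "c n ! 1 \<noteq> ctr n"
    using c_1_noncentral[OF n] by simp_all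
  let ?B = "{u \<in> V (Suc n). \<phi> (Suc n) u = c n ! 1}"
  have "cyl n {c n ! 1} = cyl (Suc n) ?B"
    using cyl_lift[of n "{c n ! 1}"] by (simp only: singleton_iff)
  then have "measure \<mu> (cyl n {c n ! 1}) = measure \<mu> (cyl (Suc n) ?B)"
    by (rule arg_cong)
  also have "\<dots> = real (card ?B) * measure \<mu> (cyl (Suc n) {c (Suc n) ! 1})"
    by (rule measure_sum_noncentral[OF _ fibre_noncentral(1)[OF n v]]) simp
  finally show ?thesis
    unfolding fibre_noncentral(2)[OF n v] .
qed

end

end

section \<open>Products and divergent sums\<close>

lemma prod_tendsto_zero_if_sum_diverges:
  fixes r :: "nat \<Rightarrow> real"
  assumes r: "\<And>i. i \<ge> 1 \<Longrightarrow> 0 \<le> r i"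
    and div: "filterlim (\<lambda>N. \<Sum>i=1..N. 1 - r i) at_top sequentially"
  shows "(\<lambda>N. \<Prod>i=1..N. r i) \<longlonglongrightarrow> 0"
proof (rule tendsto_sandwich[where f = "\<lambda>_. 0"])
  have "filterlim (\<lambda>N. - (\<Sum>i=1..N. 1 - r i)) at_bot sequentially"
    using div by (simp add: filterlim_uminus_at_top)
  then show "(\<lambda>N. exp (- (\<Sum>i=1..N. 1 - r i))) \<longlonglongrightarrow> 0"
    by (rule filterlim_compose[OF exp_at_bot])
  have "(\<Prod>i=1..N. r i) \<le> exp (- (\<Sum>i=1..N. 1 - r i))" for N
  proof -
    have "(\<Prod>i=1..N. r i) \<le> (\<Prod>i=1..N. exp (- (1 - r i)))"
    proof (rule prod_mono)
      fix i assume "i \<in> {1..N}"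
      then show "0 \<le> r i \<and> r i \<le> exp (- (1 - r i))"
        using r[of i] exp_ge_add_one_self[of "- (1 - r i)"] by auto
    qed
    also have "\<dots> = exp (- (\<Sum>i=1..N. 1 - r i))"
      by (simp add: exp_sum[symmetric] sum_negf[symmetric])
    finally show ?thesis .
  qed
  then show "\<forall>\<^sub>F N in sequentially. (\<Prod>i=1..N. r i) \<le> exp (- (\<Sum>i=1..N. 1 - r i))"
    by simp
  show "\<forall>\<^sub>F N in sequentially. 0 \<le> (\<Prod>i=1..N. r i)"
    by (auto intro!: always_eventually prod_nonneg r)
qed simp

text \<open>
  The terms \<open>1 - r i\<close> are nonnegative, so a sum that does not diverge converges, and the product
  converges absolutely.  As no factor vanishes, its limit is positive, and it is a lower bound because
  the partial products decrease.
\<close>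

lemma prod_bounded_below_if_sum_not_diverges:
  fixes r :: "nat \<Rightarrow> real"
  assumes r: "\<And>i. i \<ge> 1 \<Longrightarrow> 0 < r i" "\<And>i. i \<ge> 1 \<Longrightarrow> r i \<le> 1"
    and ndiv: "\<not> filterlim (\<lambda>N. \<Sum>i=1..N. 1 - r i) at_top sequentially"
  shows "\<exists>\<delta>>0. \<forall>N. \<delta> \<le> (\<Prod>i=1..N. r i)"
proof -
  define s where "s i = 1 - r (Suc i)" for i
  have s: "0 \<le> s i" "s i < 1" for i
    using r[of "Suc i"] by (auto simp: s_def)
  have sum_s: "(\<Sum>i=1..N. 1 - r i) = (\<Sum>i<N. s i)" and prod_s: "(\<Prod>i=1..N. r i) = (\<Prod>i<N. 1 - s i)" for N
    by (simp_all add: s_def sum.atLeast1_atMost_eq prod.atLeast1_atMost_eq)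
  have inc: "mono (\<lambda>N. \<Sum>i<N. s i)"
    by (auto intro!: monoI sum_mono2 s)
  have "summable s"
  proof -
    obtain Z where "\<not> (\<forall>\<^sub>F N in sequentially. Z \<le> (\<Sum>i<N. s i))"
      using ndiv unfolding sum_s filterlim_at_top by blast
    then have "\<exists>\<^sub>F N in sequentially. (\<Sum>i<N. s i) < Z"
      by (simp add: frequently_def not_less)
    then have "(\<Sum>i<N. s i) \<le> Z" for N
      by (metis (mono_tags, lifting) frequently_sequentially inc less_imp_le monoD order_trans)
    then show ?thesis
      by (intro summableI_nonneg_bounded[of s Z] s)
  qed
  have nz: "1 + - s i \<noteq> 0" for i
    using s[of i] by auto
  have "summable (\<lambda>i. norm ((1 - s i) - 1))"
    using \<open>summable s\<close> s by simp
  then have "convergent_prod (\<lambda>i. 1 - s i)"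
    by (intro abs_convergent_prod_imp_convergent_prod summable_imp_abs_convergent_prod)
  then have conv: "(\<lambda>N. \<Prod>i\<le>N. 1 - s i) \<longlonglongrightarrow> prodinf (\<lambda>i. 1 - s i)" and p0: "prodinf (\<lambda>i. 1 - s i) \<noteq> 0"
    using nz by (auto intro!: convergent_prod_LIMSEQ simp: prodinf_nonzero)
  have dec: "decseq (\<lambda>N. \<Prod>i\<le>N. 1 - s i)"
    using s by (intro decseq_SucI) (auto intro!: mult_left_le prod_nonneg simp: less_imp_le)
  have "prodinf (\<lambda>i. 1 - s i) \<ge> 0"
    by (rule LIMSEQ_le_const[OF conv]) (use s in \<open>auto intro!: prod_nonneg simp: less_imp_le\<close>)
  with p0 have pos: "prodinf (\<lambda>i. 1 - s i) > 0"
    by linarith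
  have "prodinf (\<lambda>i. 1 - s i) \<le> (\<Prod>i\<le>N. 1 - s i)" for N
    using decseq_ge[OF dec conv] .
  moreover have "(\<Prod>i\<le>N. 1 - s i) \<le> (\<Prod>i<N. 1 - s i)" for N
    using s by (simp flip: lessThan_Suc_atMost add: mult_left_le prod_nonneg less_imp_le)
  ultimately show ?thesis
    using pos unfolding prod_s by (meson order_trans)
qed

section \<open>The criterion for unique ergodicity\<close>

text \<open>
  The quantity \<open>m n * l n\<close>, up to a factor 2 the mass outside the center, changes by the factor \<open>r n\<close>
  from one level to the next; a nonzero height can therefore exist only if the products of the \<open>r i\<close>
  stay away from 0.
\<close>

theorem (in figure_eight_covering) uniquely_ergodic_iff_sum_diverges:
  fixes r :: "nat \<Rightarrow> real"
  assumes r: "\<And>n. n \<ge> 1 \<Longrightarrow> r n = real (b n * l n) / real (l (Suc n))"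
    and le: "\<And>n. n \<ge> 1 \<Longrightarrow> b n * l n \<le> l (Suc n)"
  shows "uniquely_ergodic T F \<longleftrightarrow> filterlim (\<lambda>N. \<Sum>i=1..N. 1 - r i) at_top sequentially"
proof -
  have l_pos: "real (l n) > 0" and b_pos: "real (b n) > 0" if "n \<ge> 1" for n
    using l_ge_2[OF that] b_ge_1[OF that] by auto
  have r_pos: "0 < r n" and r_le: "r n \<le> 1" if n: "n \<ge> 1" for n
    using l_pos[OF n] b_pos[OF n] l_pos[of "Suc n"] le[OF n]
    by (auto simp: r[OF n] divide_simps simp flip: of_nat_mult)
  have telescope: "m 1 * real (l 1) = (\<Prod>i=1..N. r i) * (m (Suc N) * real (l (Suc N)))"
    if m: "\<And>n. n \<ge> 1 \<Longrightarrow> m n = real (b n) * m (Suc n)" for m :: "nat \<Rightarrow> real" and N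
  proof (induction N)
    case (Suc N)
    have "m (Suc N) * real (l (Suc N)) = r (Suc N) * (m (Suc (Suc N)) * real (l (Suc (Suc N))))"
      using m[of "Suc N"] r[of "Suc N"] l_pos[of "Suc (Suc N)"] by simp
    then show ?case
      using Suc by simp
  qed simp
  show ?thesis
  proof
    assume div: "filterlim (\<lambda>N. \<Sum>i=1..N. 1 - r i) at_top sequentially"
    have P0: "(\<lambda>N. \<Prod>i=1..N. r i) \<longlonglongrightarrow> 0"
      by (rule prod_tendsto_zero_if_sum_diverges[of r, OF less_imp_le[OF r_pos] div])
    have "\<mu> = return (top_borel T) ctr" if inv: "invariant_borel_prob T F \<mu>" for \<mu>
    proof -
      define m where "m n = measure \<mu> (cyl n {c n ! 1})" for n
      have step: "m n = real (b n) * m (Suc n)" if "n \<ge> 1" for n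
        unfolding m_def by (rule height_step[OF inv that])
      \<comment> \<open>Since \<open>l n \<le> 2 * (l n - 1)\<close>, this is at most twice the mass of the noncentral vertices.\<close>
      have bound: "m (Suc N) * real (l (Suc N)) \<le> 2" for N
      proof -
        have "real (l (Suc N)) \<le> 2 * real (l (Suc N) - 1)"
          using l_ge_2[of "Suc N"] by simp
        then have "m (Suc N) * real (l (Suc N)) \<le> m (Suc N) * (2 * real (l (Suc N) - 1))"
          by (rule mult_left_mono) (simp add: m_def)
        then show ?thesis
          using height_total[OF inv, of "Suc N"] by (simp add: m_def mult_ac)
      qed
      have "m 1 * real (l 1) \<le> (\<Prod>i=1..N. r i) * 2" for N
      proof -
        have "m 1 * real (l 1) = (\<Prod>i=1..N. r i) * (m (Suc N) * real (l (Suc N)))"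
          by (rule telescope[OF step])
        also have "\<dots> \<le> (\<Prod>i=1..N. r i) * 2"
          by (rule mult_left_mono[OF bound prod_nonneg]) (use r_pos in \<open>auto intro: less_imp_le\<close>)
        finally show ?thesis .
      qed
      moreover have "(\<lambda>N. (\<Prod>i=1..N. r i) * 2) \<longlonglongrightarrow> 0"
        using tendsto_mult_right[OF P0, of 2] by simp
      ultimately have "m 1 * real (l 1) \<le> 0"
        by (intro LIMSEQ_le_const[where X = "\<lambda>N. (\<Prod>i=1..N. r i) * 2"]) auto
      then have "m 1 \<le> 0"
        using l_pos[of 1] by (simp add: mult_le_0_iff)
      then have m1: "m 1 = 0"
        by (simp add: m_def measure_le_0_iff)
      have m0: "m (Suc n) = 0" for n
      proof (induction n)
        case (Suc n)
        then show ?case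
          using step[of "Suc n"] b_pos[of "Suc n"] by simp
      qed (use m1 in simp)
      show ?thesis
      proof (rule prob_measure_eqI_cyl[where p = ctr])
        show "prob_space \<mu>" "sets \<mu> = sets (top_borel T)"
          using inv by (simp_all add: invariant_borel_prob_altdef)
        show "prob_space (return (top_borel T) ctr)"
          using dirac_invariant by (simp add: invariant_borel_prob_altdef)
        fix n v assume v: "v \<in> V (Suc n)" "v \<noteq> ctr (Suc n)"
        have "measure \<mu> (cyl (Suc n) {v}) = 0"
          using measure_noncentral[OF inv _ v] m0[of n] by (simp add: m_def)
        moreover have "ctr \<notin> cyl (Suc n) {v}"
          using v(2) by (auto simp: cyl_def)
        ultimately show "measure \<mu> (cyl (Suc n) {v}) = measure (return (top_borel T) ctr) (cyl (Suc n) {v})"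
          by (simp add: measure_return cyl_in_sets)
      qed simp
    qed
    then show "uniquely_ergodic T F"
      unfolding uniquely_ergodic_def using dirac_invariant by blast
  next
    assume ue: "uniquely_ergodic T F"
    show "filterlim (\<lambda>N. \<Sum>i=1..N. 1 - r i) at_top sequentially"
    proof (rule ccontr)
      assume "\<not> ?thesis"
      then obtain \<delta> where \<delta>: "\<delta> > 0" "\<And>N. \<delta> \<le> (\<Prod>i=1..N. r i)"
        using prod_bounded_below_if_sum_not_diverges[of r, OF r_pos r_le] by blast
      \<comment> \<open>The solution of the recursion \<open>m n = b n * m (Suc n)\<close> with \<open>m 1 * l 1 = \<delta>\<close>.\<close>
      define m where "m n = \<delta> / (real (l 1) * (\<Prod>i=1..<n. real (b i)))" for n
      have step: "m n = real (b n) * m (Suc n)" if "n \<ge> 1" for n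
        using that b_pos[OF that] by (simp add: m_def)
      have m_pos: "m n > 0" for n
        using \<delta>(1) l_pos[of 1] b_pos by (auto simp: m_def intro!: divide_pos_pos mult_pos_pos prod_pos)
      have total: "real (l n - 1) * m n \<le> 1" if n: "n \<ge> 1" for n
      proof -
        obtain N where N: "n = Suc N"
          using n by (cases n) auto
        have "m 1 * real (l 1) = \<delta>"
          using l_pos[of 1] by (simp add: m_def)
        then have "\<delta> = (\<Prod>i=1..N. r i) * (m n * real (l n))"
          using telescope[OF step, of N] by (simp only: N)
        moreover have "0 \<le> m n * real (l n)"
          using m_pos[of n] by simp
        \<comment> \<open>Telescoping writes \<open>\<delta>\<close> as a product at least \<open>\<delta>\<close> times \<open>m n * l n\<close>, which is therefore at most 1.\<close>
        ultimately have "\<delta> \<ge> \<delta> * (m n * real (l n))"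
          using mult_right_mono[OF \<delta>(2)[of N]] by metis
        then have "m n * real (l n) \<le> 1"
          using \<delta>(1) by simp
        moreover have "real (l n - 1) * m n \<le> real (l n) * m n"
          using m_pos[of n] by (intro mult_right_mono) auto
        ultimately show ?thesis
          by (simp add: mult.commute)
      qed
      obtain \<mu> where \<mu>: "invariant_borel_prob T F \<mu>" "measure \<mu> (cyl 1 {c 1 ! 1}) = m 1"
        using ex_invariant_with_heights[of m, OF less_imp_le[OF m_pos] total step] by blast
      have "ctr \<notin> cyl 1 {c 1 ! 1}"
        using c_ne_ctr[of 1 1] l_ge_2[of 1] by (auto simp: cyl_def)
      then have "measure (return (top_borel T) ctr) (cyl 1 {c 1 ! 1}) = 0"
        by (simp add: measure_return cyl_in_sets)
      then have "\<mu> \<noteq> return (top_borel T) ctr"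
        using \<mu>(2) m_pos[of 1] by auto
      then show False
        using ue \<mu>(1) dirac_invariant unfolding uniquely_ergodic_def by blast
    qed
  qed
qed

section \<open>Images of circuits as lists of vertices\<close>

lemma set_vwalk_arcs: "set (vwalk_arcs p) = (\<lambda>i. (p ! i, p ! Suc i)) ` {..<length p - 1}"
  by (induction p rule: vwalk_arcs.induct) (simp_all add: lessThan_Suc_eq_insert_0 image_image)

text \<open>
  Concatenation of walks drops the repeated base point, which is the head of each factor.
\<close>

lemma walk_prod_eq_concat:
  assumes "\<And>w. w \<in> set ws \<Longrightarrow> w \<noteq> [] \<and> hd w = v"
  shows "walk_prod v ws = v # concat (map tl ws)"
  using assms
proof (induction ws)
  case (Cons w ws)
  then have "w = v # tl w"
    by (metis list.collapse list.set_intros(1))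
  moreover have "walk_prod v (w # ws) = vwalk_join w (v # concat (map tl ws))"
    using Cons by (simp add: walk_prod_def)
  ultimately show ?case
    by (simp add: vwalk_join_def)
qed (simp add: walk_prod_def)

lemma walk_pow_loop: "walk_pow v [v, v] k = v # replicate k v"
proof -
  have "concat (replicate k [v]) = replicate k v"
    by (induction k) auto
  then show ?thesis
    using walk_prod_eq_concat[of "replicate k [v, v]" v] by (simp add: walk_pow_def)
qed

lemma circuit_interleaved_with_loops:
  assumes p: "p \<noteq> []" "hd p = v"
  shows "walk_prod v (walk_pow v [v, v] (a 0) #
             map (\<lambda>j. walk_prod v [p, walk_pow v [v, v] (a j)]) [1..<b + 1]) =
           v # replicate (a 0) v @ concat (map (\<lambda>j. tl p @ replicate (a j) v) [1..<b + 1])"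
proof -
  have "walk_prod v [p, walk_pow v [v, v] (a j)] = v # tl p @ replicate (a j) v" for j
    using p by (subst walk_prod_eq_concat) (auto simp: walk_pow_loop)
  then show ?thesis
    by (subst walk_prod_eq_concat) (auto simp: walk_pow_loop comp_def)
qed

lemma length_circuit_interleaved:
  "length (v # replicate (a 0) v @ concat (map (\<lambda>j. tl p @ replicate (a j) v) [1..<b + 1])) =
     Suc (b * length (tl p) + (\<Sum>j=0..b. a j))"
proof -
  have "length (concat (map (\<lambda>j. tl p @ replicate (a j) v) [1..<b + 1])) = b * length (tl p) + (\<Sum>j=1..b. a j)"
    by (induction b) (simp_all del: length_tl)
  moreover have "(\<Sum>j=0..b. a j) = a 0 + (\<Sum>j=1..b. a j)"
    by (simp add: sum.atLeast_Suc_atMost)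
  ultimately show ?thesis
    by (simp del: length_tl)
qed

lemma count_circuit_interleaved:
  assumes "u \<noteq> v"
  shows "count_list (v # replicate (a 0) v @ concat (map (\<lambda>j. tl p @ replicate (a j) v) [1..<b + 1])) u =
     b * count_list (tl p) u"
proof -
  have [simp]: "count_list (replicate k v) u = 0" for k
    using assms by (induction k) auto
  have "count_list (concat (map (\<lambda>j. tl p @ replicate (a j) v) [1..<b + 1])) u = b * count_list (tl p) u"
    by (induction b) auto
  then show ?thesis
    using assms by simp
qed

lemma card_nth_eq_count_list: "card {i. i < length xs \<and> xs ! i = u} = count_list xs u"
  by (simp add: count_list_eq_length_filter length_filter_conv_card eq_commute)

text \<open>
  The tail of a circuit lists each of its vertices once, because the base point is dropped at the
  start and repeated at the end.
\<close>

lemma count_list_tl_circuit: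
  assumes "circuit H p" "u \<in> set p" "u \<noteq> hd p"
  shows "count_list (tl p) u = 1"
proof -
  obtain v q where p: "p = v # q" and q: "q \<noteq> []" "last q = v" and dist: "distinct (v # butlast q)"
    using assms(1) by (cases p) (auto simp: circuit_def split: if_splits)
  have q_eq: "q = butlast q @ [v]"
    using q by (metis append_butlast_last_id)
  have "u \<noteq> v" "u \<in> set q"
    using assms(2,3) p by simp_all
  moreover have "set q = insert v (set (butlast q))"
    using arg_cong[OF q_eq, of set] by simp
  ultimately have "u \<in> set (butlast q)"
    by blast
  then have "count_list (butlast q) u = 1"
    using dist by (simp add: count_list_eq_length_filter distinct_length_filter Int_absorb2 singleton_conv2)
  then have "count_list (butlast q @ [v]) u = 1"
    using \<open>u \<noteq> v\<close> by simp
  then show ?thesis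
    using q_eq p by simp
qed

lemma circuit_arcs: "circuit H w \<Longrightarrow> set (vwalk_arcs w) \<subseteq> parcs H"
  by (simp add: circuit_def vwalk_def)

text \<open>
  The family of circuits in the definition is only asserted to exist, but since the arcs of any circuit
  are arcs of the graph, the family may be replaced by all circuits at the center.
\<close>

lemma generalized_figure_8_arcs:
  assumes fig: "generalized_figure_8 H v k"
  shows "parcs H = (\<Union>w\<in>{w. circuit H w \<and> hd w = v}. set (vwalk_arcs w))"
proof
  show "parcs H \<subseteq> (\<Union>w\<in>{w. circuit H w \<and> hd w = v}. set (vwalk_arcs w))"
    using fig unfolding generalized_figure_8_def by blast
  show "(\<Union>w\<in>{w. circuit H w \<and> hd w = v}. set (vwalk_arcs w)) \<subseteq> parcs H"
    using circuit_arcs by blast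
qed

lemma circuit_length_1:
  assumes "circuit H w" "vwalk_length w = 1"
  shows "w = [hd w, hd w]"
proof -
  have "length w = 2" "hd w = last w"
    using assms by (auto simp: circuit_def)
  then show ?thesis
    by (auto simp: length_Suc_conv numeral_2_eq_2)
qed

text \<open>
  Read as a list of vertices, the image of \<open>c (Suc n)\<close> is \<open>b n\<close> copies of \<open>c n\<close> interleaved with
  repetitions of the center.  Its length gives the recursion for \<open>l\<close>, its second entry is the center
  because \<open>a n 0 > 0\<close>, and a noncentral vertex occurs once in each copy.
\<close>

lemma figure_eight_covering_if_circuits:
  fixes G :: "nat \<Rightarrow> 'v pair_pre_digraph" and a :: "nat \<Rightarrow> nat \<Rightarrow> nat"
  assumes KR: "KR_covering G \<phi> ctr"
    and circuits: "\<And>n. n \<ge> 1 \<Longrightarrow> {w. circuit (G n) w \<and> hd w = ctr n} = {e n, c n}"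
    and e_len: "\<And>n. n \<ge> 1 \<Longrightarrow> vwalk_length (e n) = 1"
    and c_len: "\<And>n. n \<ge> 1 \<Longrightarrow> vwalk_length (c n) = l n" and l_ge_2: "\<And>n. n \<ge> 1 \<Longrightarrow> l n \<ge> 2"
    and b_ge_1: "\<And>n. n \<ge> 1 \<Longrightarrow> b n \<ge> 1" and a_0: "\<And>n. n \<ge> 1 \<Longrightarrow> a n 0 > 0"
    and image: "\<And>n. n \<ge> 1 \<Longrightarrow>
           map (\<phi> (Suc n)) (c (Suc n)) =
           walk_prod (ctr n)
             (walk_pow (ctr n) (e n) (a n 0) #
              map (\<lambda>j. walk_prod (ctr n) [c n, walk_pow (ctr n) (e n) (a n j)]) [1..<b n + 1])"
  shows "figure_eight_covering G \<phi> ctr c l b"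
    and "\<And>n. n \<ge> 1 \<Longrightarrow> l (Suc n) = b n * l n + (\<Sum>j=0..b n. a n j)"
proof -
  interpret graph_covering G \<phi>
    using KR by unfold_locales (simp add: KR_covering_def)
  have circ_c: "circuit (G n) (c n)" and hd_c: "hd (c n) = ctr n"
    and circ_e: "circuit (G n) (e n)" and hd_e: "hd (e n) = ctr n" if n: "n \<ge> 1" for n
    using circuits[OF n] by blast+
  have e_eq: "e n = [ctr n, ctr n]" if n: "n \<ge> 1" for n
    using circuit_length_1[OF circ_e[OF n] e_len[OF n]] hd_e[OF n] by simp
  have length_c: "length (c n) = Suc (l n)" if n: "n \<ge> 1" for n
    using c_len[OF n] l_ge_2[OF n] by simp
  then have c_ne: "c n \<noteq> []" if n: "n \<ge> 1" for n
    using n by force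
  have c_0: "c n ! 0 = ctr n" if n: "n \<ge> 1" for n
    using hd_c[OF n] c_ne[OF n] by (simp add: hd_conv_nth)
  have c_l: "c n ! l n = ctr n" if n: "n \<ge> 1" for n
    using circ_c[OF n] hd_c[OF n] c_ne[OF n] length_c[OF n] by (simp add: circuit_def last_conv_nth)
  have c_inj: "inj_on ((!) (c n)) {..<l n}" if n: "n \<ge> 1" for n
  proof (rule inj_onI)
    fix i j assume ij: "i \<in> {..<l n}" "j \<in> {..<l n}" "c n ! i = c n ! j"
    have "distinct (butlast (c n))" "length (butlast (c n)) = l n"
      using circ_c[OF n] length_c[OF n] by (simp_all add: circuit_def)
    moreover have "butlast (c n) ! i = butlast (c n) ! j"
      using ij length_c[OF n] by (simp add: nth_butlast)
    ultimately show "i = j"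
      using ij(1,2) by (simp add: nth_eq_iff_index_eq)
  qed
  have fig: "\<exists>k. generalized_figure_8 (G n) (ctr n) k" for n
    using KR by (simp add: KR_covering_def)
  have arcs_eq: "parcs (G n) = insert (ctr n, ctr n) {(c n ! i, c n ! Suc i) | i. i < l n}" if n: "n \<ge> 1" for n
  proof -
    obtain k where "generalized_figure_8 (G n) (ctr n) k"
      using fig by blast
    then have "parcs (G n) = (\<Union>w\<in>{e n, c n}. set (vwalk_arcs w))"
      unfolding circuits[OF n, symmetric] by (rule generalized_figure_8_arcs)
    also have "\<dots> = insert (ctr n, ctr n) ((\<lambda>i. (c n ! i, c n ! Suc i)) ` {..<l n})"
      by (simp add: e_eq[OF n] set_vwalk_arcs lessThan_Suc length_c[OF n])
    finally show ?thesis
      by blast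
  qed
  let ?I = "\<lambda>n. ctr n # replicate (a n 0) (ctr n) @
      concat (map (\<lambda>j. tl (c n) @ replicate (a n j) (ctr n)) [1..<b n + 1])"
  have image': "map (\<phi> (Suc n)) (c (Suc n)) = ?I n" if n: "n \<ge> 1" for n
    unfolding image[OF n] e_eq[OF n]
    by (rule circuit_interleaved_with_loops[OF c_ne[OF n] hd_c[OF n]])
  have nth_image: "\<phi> (Suc n) (c (Suc n) ! j) = ?I n ! j" if "n \<ge> 1" "j \<le> l (Suc n)" for n j
    using that length_c[of "Suc n"] image'[OF that(1), symmetric] by simp
  have \<phi>_ctr: "\<phi> (Suc n) (ctr (Suc n)) = ctr n" for n
    using KR by (simp add: KR_covering_def)
  show len: "l (Suc n) = b n * l n + (\<Sum>j=0..b n. a n j)" if n: "n \<ge> 1" for n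
    using arg_cong[OF image'[OF n], of length] length_circuit_interleaved[of "ctr n" "a n" "c n" "b n"]
      length_c[OF n] length_c[of "Suc n"] by simp
  show "figure_eight_covering G \<phi> ctr c l b"
  proof
    obtain v where "V 0 = {v}"
      using covering by (auto simp: covering_def)
    moreover have "ctr 0 \<in> V 0"
      using fig[of 0] by (auto simp: generalized_figure_8_def)
    ultimately show "V 0 = {ctr 0}"
      by simp
    show "\<phi> (Suc n) (c (Suc n) ! 1) = ctr n" if n: "n \<ge> 1" for n
    proof -
      have "\<phi> (Suc n) (c (Suc n) ! 1) = ?I n ! 1"
        using nth_image[OF n, of 1] l_ge_2[of "Suc n"] by simp
      also have "\<dots> = ctr n"
        using a_0[OF n] by (simp add: nth_append)
      finally show ?thesis .
    qed
    show "card {j \<in> {1..<l (Suc n)}. \<phi> (Suc n) (c (Suc n) ! j) = v} = b n"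
      if n: "n \<ge> 1" and v: "v \<in> V n" "v \<noteq> ctr n" for n v
    proof -
      let ?xs = "map (\<phi> (Suc n)) (c (Suc n))"
      obtain w where "(v, w) \<in> parcs (G n)"
        using ex_out_arc[OF v(1)] by blast
      then obtain i where "i < l n" "v = c n ! i"
        using v(2) unfolding arcs_eq[OF n] by blast
      then have v_c: "v \<in> set (c n)"
        using length_c[OF n] by simp
      have ends: "?xs ! 0 = ctr n" "?xs ! l (Suc n) = ctr n"
        using length_c[of "Suc n"] c_0[of "Suc n"] c_l[of "Suc n"] \<phi>_ctr[of n] c_ne[of "Suc n"]
        by (simp_all)
      have "{j \<in> {1..<l (Suc n)}. \<phi> (Suc n) (c (Suc n) ! j) = v} = {j. j < length ?xs \<and> ?xs ! j = v}"
      proof (intro Collect_cong iffI)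
        fix j assume j: "j < length ?xs \<and> ?xs ! j = v"
        then have "j \<noteq> 0" "j \<noteq> l (Suc n)"
          using ends v(2) by metis+
        then show "j \<in> {1..<l (Suc n)} \<and> \<phi> (Suc n) (c (Suc n) ! j) = v"
          using j length_c[of "Suc n"] by auto
      qed (use length_c[of "Suc n"] in simp)
      then have "card {j \<in> {1..<l (Suc n)}. \<phi> (Suc n) (c (Suc n) ! j) = v} = count_list ?xs v"
        by (simp only: card_nth_eq_count_list)
      also have "\<dots> = b n * count_list (tl (c n)) v"
        unfolding image'[OF n] using v(2) by (rule count_circuit_interleaved)
      also have "\<dots> = b n"
        using count_list_tl_circuit[OF circ_c[OF n] v_c] v(2) hd_c[OF n] by simp
      finally show ?thesis .
    qed
  qed (fact \<phi>_ctr l_ge_2 arcs_eq c_0 c_l c_inj b_ge_1)+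
qed

theorem theorem6p20:
  fixes X :: "'a metric" and f :: "'a \<Rightarrow> 'a"
    and G :: "nat \<Rightarrow> 'v pair_pre_digraph" and \<phi> :: "nat \<Rightarrow> 'v \<Rightarrow> 'v" and ctr :: "nat \<Rightarrow> 'v"
    and e c :: "nat \<Rightarrow> 'v vwalk" and l b :: "nat \<Rightarrow> nat"
    and a :: "nat \<Rightarrow> nat \<Rightarrow> nat" and r :: "nat \<Rightarrow> real"
  assumes "cantor_system X f" and "proximal_system X f" and "has_topological_rank X f 2"
    and "bidirectional_covering G \<phi>" and "proximal_KR_covering G \<phi> ctr"
    and "top_conjugate (mtopology_of X) f (inv_limit_topology G \<phi>) (inv_limit_map G \<phi>)"
    and "\<And>n. n \<ge> 1 \<Longrightarrow> {w. circuit (G n) w \<and> hd w = ctr n} = {e n, c n}"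
    and "\<And>n. n \<ge> 1 \<Longrightarrow> vwalk_length (e n) = 1"
    and "\<And>n. n \<ge> 1 \<Longrightarrow> vwalk_length (c n) = l n \<and> l n \<ge> 2"
    and "\<And>n. n \<ge> 1 \<Longrightarrow> b n \<ge> 1 \<and> a n 0 > 0 \<and> a n (b n) > 0"
    and "\<And>n. n \<ge> 1 \<Longrightarrow>
           map (\<phi> (n + 1)) (c (n + 1)) =
           walk_prod (ctr n)
             (walk_pow (ctr n) (e n) (a n 0) #
              map (\<lambda>j. walk_prod (ctr n) [c n, walk_pow (ctr n) (e n) (a n j)]) [1..<b n + 1])"
    and "\<And>n. n \<ge> 1 \<Longrightarrow>
           r n = (real (l (n + 1)) - (\<Sum>j=0..b n. real (a n j))) / real (l (n + 1))"
  shows "uniquely_ergodic (mtopology_of X) f \<longleftrightarrow>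
         filterlim (\<lambda>N. \<Sum>i=1..N. 1 - r i) at_top sequentially"
proof -
  have KR: "KR_covering G \<phi> ctr"
    using assms(5) by (simp add: proximal_KR_covering_def)
  have "\<And>n. n \<ge> 1 \<Longrightarrow> vwalk_length (c n) = l n" "\<And>n. n \<ge> 1 \<Longrightarrow> l n \<ge> 2"
    "\<And>n. n \<ge> 1 \<Longrightarrow> b n \<ge> 1" "\<And>n. n \<ge> 1 \<Longrightarrow> a n 0 > 0"
    using assms(9,10) by blast+
  moreover have "map (\<phi> (Suc n)) (c (Suc n)) = walk_prod (ctr n)
      (walk_pow (ctr n) (e n) (a n 0) #
       map (\<lambda>j. walk_prod (ctr n) [c n, walk_pow (ctr n) (e n) (a n j)]) [1..<b n + 1])" if "n \<ge> 1" for n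
    using assms(11)[OF that] by (simp only: Suc_eq_plus1)
  ultimately have fe: "figure_eight_covering G \<phi> ctr c l b"
    and len: "l (Suc n) = b n * l n + (\<Sum>j=0..b n. a n j)" if "n \<ge> 1" for n
    using figure_eight_covering_if_circuits[OF KR assms(7,8), of l b a] that by blast+
  interpret figure_eight_covering G \<phi> ctr c l b
    by (rule fe[OF order_refl])
  have "f \<in> topspace (mtopology_of X) \<rightarrow> topspace (mtopology_of X)"
    using assms(1) homeomorphic_imp_surjective_map
    unfolding cantor_system_def zero_dim_system_def by blast
  then have "uniquely_ergodic (mtopology_of X) f \<longleftrightarrow> uniquely_ergodic T F"
    by (rule uniquely_ergodic_top_conjugate[OF assms(6)])
  also have "\<dots> \<longleftrightarrow> filterlim (\<lambda>N. \<Sum>i=1..N. 1 - r i) at_top sequentially"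
  proof (rule uniquely_ergodic_iff_sum_diverges)
    fix n :: nat assume n: "n \<ge> 1"
    show "r n = real (b n * l n) / real (l (Suc n))"
      using assms(12)[OF n] len[OF n] by simp
    show "b n * l n \<le> l (Suc n)"
      using len[OF n] by simp
  qed
  finally show ?thesis .
qed

end
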